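(* Let $\mathcal{H}$ be a separable complex Hilbert space and let $P\in\mathcal{B}(\mathcal{H})$ be a bounded idempotent ($P^2=P$, not necessarily self-adjoint), written as $$P=\begin{pmatrix}I&P_1\\0&0\end{pmatrix}\ \text{on } R(P)\oplus R(P)^{\perp},\qquad P_1\in\mathcal{B}(R(P)^{\perp},R(P)).$$ Let $J\in\mathcal{B}(\mathcal{H})$ be a symmetry, i.e. $J=J^{\ast}=J^{-1}$. Then $P^{\ast}JP\leqslant J$ if and only if $$J=\begin{pmatrix}J_1(I+P_1P_1^{\ast})^{-\frac12}&J_1(I+P_1P_1^{\ast})^{-\frac12}P_1\\ P_1^{\ast}(I+P_1P_1^{\ast})^{-\frac12}J_1&(I+P_1^{\ast}P_1)^{-\frac12}\end{pmatrix}\ \text{on } R(P)\oplus R(P)^{\perp},$$ for some symmetry $J_1\in\mathcal{B}(R(P))$ (i.e. $J_1=J_1^{\ast}=J_1^{-1}$) with $J_1P_1+P_1=0$.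
   Context: $R(T)$ denotes the range of $T$. For self-adjoint operators, $A\leqslant B$ (Loewner order) means $\langle (B-A)x,x\rangle\geqslant 0$ for all $x$. Every bounded idempotent $P$ has a (unique) matrix of the stated form with respect to the orthogonal decomposition $\mathcal{H}=R(P)\oplus R(P)^{\perp}$. *)

theory Defs
  imports "HOL-Analysis.Analysis"
begin

(* A complex inner product space is a real one with a compatible complex structure, so that
   norm, topology, completeness and separability are those of the library.  The complex inner
   product is linear in its first argument; its positivity and its relation to the norm follow
   from real_inner, since cinner x x is real with real part inner x x. *)
class complex_inner = real_inner +
  fixes scaleC :: "complex \<Rightarrow> 'a \<Rightarrow> 'a"  (infixr \<open>*\<^sub>C\<close> 75)
    and cinner :: "'a \<Rightarrow> 'a \<Rightarrow> complex"
  assumes scaleC_add_right: "c *\<^sub>C (x + y) = c *\<^sub>C x + c *\<^sub>C y"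
    and scaleC_add_left: "(c + d) *\<^sub>C x = c *\<^sub>C x + d *\<^sub>C x"
    and scaleC_scaleC: "c *\<^sub>C (d *\<^sub>C x) = (c * d) *\<^sub>C x"
    and scaleC_of_real: "complex_of_real r *\<^sub>C x = r *\<^sub>R x"
    and cinner_commute: "cinner x y = cnj (cinner y x)"
    and cinner_add_left: "cinner (x + y) z = cinner x z + cinner y z"
    and cinner_scaleC_left: "cinner (c *\<^sub>C x) y = c * cinner x y"
    and Re_cinner: "Re (cinner x y) = inner x y"

class chilbert_space = complex_inner + complete_space

instantiation complex :: chilbert_space
begin

definition scaleC_complex :: "complex \<Rightarrow> complex \<Rightarrow> complex" where
  "scaleC_complex c x = c * x"

definition cinner_complex :: "complex \<Rightarrow> complex \<Rightarrow> complex" where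
  "cinner_complex x y = x * cnj y"

instance
  by standard
    (simp_all add: scaleC_complex_def cinner_complex_def algebra_simps
      scaleR_conv_of_real inner_complex_def)

end

(* Operators between subspaces M and N of a Hilbert space are represented by functions on the
   ambient type, of which only the values on M matter; equality of two such operators is
   pointwise equality on M. *)
definition bounded_ops :: "'a::complex_inner set \<Rightarrow> 'a set \<Rightarrow> ('a \<Rightarrow> 'a) set" where
  "bounded_ops M N = {T.
     (\<forall>x\<in>M. T x \<in> N) \<and>
     (\<forall>x\<in>M. \<forall>y\<in>M. T (x + y) = T x + T y) \<and>
     (\<forall>c. \<forall>x\<in>M. T (c *\<^sub>C x) = c *\<^sub>C T x) \<and>
     (\<exists>K. \<forall>x\<in>M. norm (T x) \<le> K * norm x)}"

definition ortho_compl :: "'a::complex_inner set \<Rightarrow> 'a set" where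
  "ortho_compl M = {y. \<forall>x\<in>M. cinner x y = 0}"

(* For closed subspaces M, N and T in B(M,N) the adjoint exists and is unique on N. *)
definition adj :: "'a::complex_inner set \<Rightarrow> 'a set \<Rightarrow> ('a \<Rightarrow> 'a) \<Rightarrow> ('a \<Rightarrow> 'a)" where
  "adj M N T = (SOME S. S \<in> bounded_ops N M \<and>
     (\<forall>x\<in>M. \<forall>y\<in>N. cinner (T x) y = cinner x (S y)))"

definition positive_op :: "'a::complex_inner set \<Rightarrow> ('a \<Rightarrow> 'a) \<Rightarrow> bool" where
  "positive_op M T \<longleftrightarrow> T \<in> bounded_ops M M \<and> (\<forall>x\<in>M. cinner (T x) x \<in> \<real>\<^sub>\<ge>\<^sub>0)"

(* For a closed subspace M and a positive operator T on M the positive square root exists and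
   is unique on M. *)
definition sqrt_op :: "'a::complex_inner set \<Rightarrow> ('a \<Rightarrow> 'a) \<Rightarrow> ('a \<Rightarrow> 'a)" where
  "sqrt_op M T = (SOME S. positive_op M S \<and> (\<forall>x\<in>M. S (S x) = T x))"

definition inv_sqrt_op :: "'a::complex_inner set \<Rightarrow> ('a \<Rightarrow> 'a) \<Rightarrow> ('a \<Rightarrow> 'a)" where
  "inv_sqrt_op M T = inv_into M (sqrt_op M T)"

definition symmetry_on :: "'a::complex_inner set \<Rightarrow> ('a \<Rightarrow> 'a) \<Rightarrow> bool" where
  "symmetry_on M J \<longleftrightarrow> J \<in> bounded_ops M M \<and>
     (\<forall>x\<in>M. adj M M J x = J x) \<and> (\<forall>x\<in>M. J (J x) = x)"

definition loewner_le :: "('a::complex_inner \<Rightarrow> 'a) \<Rightarrow> ('a \<Rightarrow> 'a) \<Rightarrow> bool" where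
  "loewner_le A B \<longleftrightarrow> (\<forall>x. cinner (B x - A x) x \<in> \<real>\<^sub>\<ge>\<^sub>0)"

(* T = (A, B; C, D) with respect to the orthogonal decomposition of the space into M and its
   orthogonal complement. *)
definition has_block_form ::
  "'a::complex_inner set \<Rightarrow> ('a \<Rightarrow> 'a) \<Rightarrow>
   ('a \<Rightarrow> 'a) \<Rightarrow> ('a \<Rightarrow> 'a) \<Rightarrow> ('a \<Rightarrow> 'a) \<Rightarrow> ('a \<Rightarrow> 'a) \<Rightarrow> bool" where
  "has_block_form M T A B C D \<longleftrightarrow>
     A \<in> bounded_ops M M \<and> B \<in> bounded_ops (ortho_compl M) M \<and>
     C \<in> bounded_ops M (ortho_compl M) \<and> D \<in> bounded_ops (ortho_compl M) (ortho_compl M) \<and>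
     (\<forall>x\<in>M. \<forall>y\<in>ortho_compl M. T (x + y) = (A x + B y) + (C x + D y))"

end

theory Submission
  imports Defs
begin

text \<open>
  Let \<open>E\<close> be the orthogonal projection onto \<open>R(P)\<close> and \<open>F = P - E\<close>, so that \<open>F\<close> is \<open>P\<^sub>1\<close> extended by 0.
  The operator \<open>W = I + F F\<^sup>* + F\<^sup>* F\<close> is diagonal with blocks \<open>I + P\<^sub>1 P\<^sub>1\<^sup>*\<close> and \<open>I + P\<^sub>1\<^sup>* P\<^sub>1\<close>, so
  both inverse square roots in the statement are restrictions of \<open>V = W\<^sup>-\<^sup>1\<^sup>/\<^sup>2\<close>, and \<open>V\<close> commutes
  with \<open>F\<close>.

  If \<open>K = J - P\<^sup>* J P \<ge> 0\<close>, then \<open>K\<close> vanishes on \<open>R(P)\<close> because its quadratic form does.  With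
  \<open>A = E J E\<close> this expresses the off-diagonal blocks of \<open>J\<close> through \<open>A\<close>, and \<open>J\<^sup>2 = I\<close> gives
  \<open>A W A = E\<close>.  Hence \<open>A\<close> commutes with \<open>W\<close> and \<open>J\<^sub>1 = A W\<^sup>1\<^sup>/\<^sup>2\<close> is a symmetry.  For the remaining block
  \<open>D\<close>, positivity of \<open>K\<close> on the complement of \<open>R(P)\<close> says exactly that \<open>W D\<close> is positive, and
  \<open>(W D)\<^sup>2 = W\<close> there, so \<open>D = V\<close> by uniqueness of the square root.  Conversely, for \<open>J\<close> of the
  stated form and \<open>x = r + y\<close> the form of \<open>K\<close> at \<open>x\<close> is \<open>\<langle>V y, y\<rangle> + \<langle>V F y, F y\<rangle>\<close>.
\<close>

section \<open>Square roots of coercive operators on real Hilbert spaces\<close>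

instance chilbert_space \<subseteq> banach ..

text \<open>For first variations: a nonnegative quadratic form that vanishes at \<open>r\<close>
  varies affinely along \<open>w + s r\<close>, so its mixed term must vanish.\<close>

lemma affine_nonneg_imp_slope_zero:
  fixes a b :: real
  assumes "\<And>s. 0 \<le> a + s * b"
  shows "b = 0"
proof (rule ccontr)
  assume b: "b \<noteq> 0"
  show False
    using assms[of "- (a + 1) / b"] b by simp
qed

section \<open>Projections, Riesz representation and adjoints on real Hilbert spaces\<close>

lemma norm_diff_scaleR_power2:
  fixes x z :: "'a::real_inner"
  shows "(norm (x - t *\<^sub>R z))\<^sup>2 = (norm x)\<^sup>2 - 2 * t * inner x z + t\<^sup>2 * inner z z"
  unfolding power2_norm_eq_inner
  by (simp add: inner_diff_left inner_diff_right inner_commute[of z x] power2_eq_square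
    right_diff_distrib)

text \<open>A minimizing sequence for the distance from \<open>x\<close> to \<open>M\<close> is
  Cauchy, and its limit \<open>m\<close> attains the distance; minimality along the lines
  \<open>m + t z\<close> gives orthogonality.\<close>

lemma orthogonal_projection_exists:
  fixes M :: "'a::{real_inner,banach} set"
  assumes M: "subspace M" and cl: "closed M"
  shows "\<exists>m\<in>M. \<forall>z\<in>M. inner (x - m) z = 0"
proof -
  define d where "d = Inf ((\<lambda>m. (norm (x - m))\<^sup>2) ` M)"
  have bdd: "bdd_below ((\<lambda>m. (norm (x - m))\<^sup>2) ` M)"
    by (rule bdd_belowI[of _ 0]) auto
  have ne: "(\<lambda>m. (norm (x - m))\<^sup>2) ` M \<noteq> {}"
    using subspace_0[OF M] by auto
  have dle: "d \<le> (norm (x - m))\<^sup>2" if "m \<in> M" for m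
    unfolding d_def by (rule cInf_lower) (use that bdd in auto)
  have "\<exists>m\<in>M. (norm (x - m))\<^sup>2 < d + 1 / real (Suc n)" for n
    using cInf_lessD[OF ne, of "d + 1 / real (Suc n)"] unfolding d_def by auto
  then obtain f where fM: "\<And>n. f n \<in> M" and f: "\<And>n. (norm (x - f n))\<^sup>2 < d + 1 / real (Suc n)"
    by metis
  \<comment> \<open>Parallelogram law; the midpoint of \<open>f i\<close> and \<open>f j\<close>
    lies in \<open>M\<close>, so its squared distance from \<open>x\<close> is at least
    \<open>d\<close>.\<close>
  have par: "(norm (f i - f j))\<^sup>2 \<le> 2 / real (Suc i) + 2 / real (Suc j)" for i j
  proof -
    have "(1/2) *\<^sub>R (f i + f j) \<in> M"
      using M fM by (simp add: subspace_add subspace_mul)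
    from dle[OF this]
    have "4 * d \<le> 4 * (norm (x - (1/2) *\<^sub>R (f i + f j)))\<^sup>2" by simp
    also have "\<dots> = 2 * (norm (x - f i))\<^sup>2 + 2 * (norm (x - f j))\<^sup>2 - (norm (f i - f j))\<^sup>2"
      unfolding power2_norm_eq_inner
      by (simp add: inner_add_left inner_add_right inner_diff_left inner_diff_right
        inner_commute[of "f j" "f i"] inner_commute[of "f i" x] inner_commute[of "f j" x] field_simps)
    finally show ?thesis using f[of i] f[of j] by simp
  qed
  have "Cauchy f"
  proof (rule metric_CauchyI)
    fix e :: real assume e: "0 < e"
    obtain N :: nat where N: "4 / e\<^sup>2 < real N" using reals_Archimedean2 by blast
    have "dist (f i) (f j) < e" if "i \<ge> N" "j \<ge> N" for i j
    proof -
      have N0: "real N > 0" using N e less_trans[of 0 "4 / e\<^sup>2" "real N"] by simp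
      have "2 / real (Suc i) \<le> 2 / real N" "2 / real (Suc j) \<le> 2 / real N"
        using that N0 by (auto intro!: divide_left_mono)
      then have "(norm (f i - f j))\<^sup>2 \<le> 4 / real N"
        using par[of i j] by simp
      also have "\<dots> < e\<^sup>2" using N N0 e by (simp add: field_simps)
      finally show ?thesis unfolding dist_norm
        by (rule power2_less_imp_less) (use e in simp)
    qed
    then show "\<exists>N. \<forall>i\<ge>N. \<forall>j\<ge>N. dist (f i) (f j) < e" by blast
  qed
  then obtain m where m: "f \<longlonglongrightarrow> m" using Cauchy_convergent_iff convergent_def by blast
  have mM: "m \<in> M" using closed_sequentially[OF cl _ m] fM by blast
  have "(\<lambda>n. (norm (x - f n))\<^sup>2) \<longlonglongrightarrow> (norm (x - m))\<^sup>2"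
    by (intro tendsto_intros m)
  moreover have "(\<lambda>n. d + 1 / real (Suc n)) \<longlonglongrightarrow> d + 0"
    by (intro tendsto_intros LIMSEQ_inverse_real_of_nat[unfolded inverse_eq_divide])
  ultimately have min: "(norm (x - m))\<^sup>2 \<le> d"
    using LIMSEQ_le[of "\<lambda>n. (norm (x - f n))\<^sup>2" _ "\<lambda>n. d + 1 / real (Suc n)" "d + 0"] f
    by (auto intro: less_imp_le)
  have "inner (x - m) z = 0" if z: "z \<in> M" for z
  proof (cases "z = 0")
    case False
    define t where "t = inner (x - m) z / inner z z"
    have "m + t *\<^sub>R z \<in> M" using M mM z by (simp add: subspace_add subspace_mul)
    from dle[OF this] min have "(norm (x - m))\<^sup>2 \<le> (norm (x - (m + t *\<^sub>R z)))\<^sup>2" by (rule order_trans[rotated])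
    also have "\<dots> = (norm (x - m))\<^sup>2 - 2 * t * inner (x - m) z + t\<^sup>2 * inner z z"
    proof -
      have "x - (m + t *\<^sub>R z) = (x - m) - t *\<^sub>R z" by simp
      then show ?thesis
        by (simp only: norm_diff_scaleR_power2)
    qed
    also have "\<dots> = (norm (x - m))\<^sup>2 - (inner (x - m) z)\<^sup>2 / inner z z"
      using False by (simp add: t_def power2_eq_square)
    finally have "(inner (x - m) z)\<^sup>2 / inner z z \<le> 0" by simp
    then show ?thesis using False
      using inner_gt_zero_iff[of z] by (auto simp: divide_le_0_iff simp del: inner_gt_zero_iff)
  qed simp
  with mM show ?thesis by blast
qed

text \<open>If \<open>m\<close> is the projection of \<open>u\<close> onto the kernel, then
  \<open>w = u - m\<close> is orthogonal to the kernel, which contains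
  \<open>x - (f x / f w) w\<close>.\<close>

lemma riesz_representation:
  fixes f :: "'a::{real_inner,banach} \<Rightarrow> real"
  assumes f: "bounded_linear f"
  shows "\<exists>v. \<forall>x. f x = inner x v"
proof (cases "\<forall>x. f x = 0")
  case True
  then show ?thesis by (intro exI[of _ 0]) simp
next
  case False
  then obtain u where u: "f u \<noteq> 0" by blast
  interpret f: bounded_linear f by fact
  have "subspace (f -` {0})" by (auto simp: subspace_def f.add f.scaleR f.zero)
  moreover have "closed (f -` {0})"
    using f.continuous_on[OF continuous_on_id] by (simp add: closed_vimage continuous_on_eq_continuous_at)
  ultimately obtain m where m: "f m = 0" "\<And>z. f z = 0 \<Longrightarrow> inner (u - m) z = 0"
    using orthogonal_projection_exists[of "f -` {0}" u] by auto
  define w where "w = u - m"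
  have fw: "f w \<noteq> 0" using u m by (simp add: w_def f.diff)
  then have w: "w \<noteq> 0" using f.zero by auto
  have "f x = inner x ((f w / inner w w) *\<^sub>R w)" for x
  proof -
    have "inner w (x - (f x / f w) *\<^sub>R w) = 0"
      unfolding w_def by (rule m) (use fw in \<open>simp add: f.diff f.scaleR w_def\<close>)
    then have "inner w x = f x / f w * inner w w" by (simp add: inner_diff_right)
    then show ?thesis using fw w by (simp add: inner_commute)
  qed
  then show ?thesis by blast
qed

lemma real_adjoint_exists:
  fixes f :: "'a::{real_inner,banach} \<Rightarrow> 'b::real_inner"
  assumes f: "bounded_linear f"
  shows "\<exists>g. bounded_linear g \<and> (\<forall>x y. inner (f x) y = inner x (g y))"
proof -
  interpret f: bounded_linear f by fact
  have "\<exists>v. \<forall>x. inner (f x) y = inner x v" for y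
    by (rule riesz_representation) (rule bounded_linear_compose[OF bounded_linear_inner_left f])
  then obtain g where g: "\<And>x y. inner (f x) y = inner x (g y)"
    by metis
  obtain K where K: "\<And>x. norm (f x) \<le> norm x * K" "K \<ge> 0"
    using f.nonneg_bounded by blast
  have "bounded_linear g"
  proof (rule bounded_linear_intro[of _ K])
    show "g (x + y) = g x + g y" for x y
      by (subst vector_eq_ldot[symmetric]) (simp add: inner_add_right g[symmetric])
    show "g (r *\<^sub>R x) = r *\<^sub>R g x" for r x
      by (subst vector_eq_ldot[symmetric]) (simp add: g[symmetric])
    show "norm (g y) \<le> norm y * K" for y
    proof -
      have "norm (g y) * norm (g y) = inner (f (g y)) y" by (simp add: g norm_eq_sqrt_inner)
      also have "\<dots> \<le> norm (f (g y)) * norm y" using norm_cauchy_schwarz by blast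
      also have "\<dots> \<le> norm (g y) * K * norm y" by (intro mult_right_mono K) simp
      finally show ?thesis
        by (cases "g y = 0") (use K in \<open>auto simp: mult.commute mult.left_commute\<close>)
    qed
  qed
  with g show ?thesis by blast
qed

text \<open>Expanding the square leaves the factor \<open>1 - 2 t m + t^2 c^2\<close>, which is
  smallest at \<open>t = m / c^2\<close>. Both the inverse and the square root below rest on this
  contraction.\<close>

lemma coercive_contraction:
  fixes f :: "'a::real_inner \<Rightarrow> 'a"
  assumes f: "bounded_linear f" and m: "m > 0" and co: "\<And>x. m * inner x x \<le> inner (f x) x"
  shows "\<exists>t>0. \<exists>q. 0 \<le> q \<and> q < 1 \<and> (\<forall>x. norm (x - t *\<^sub>R f x) \<le> q * norm x)"
proof -
  interpret f: bounded_linear f by fact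
  obtain K where K: "\<And>x. norm (f x) \<le> norm x * K" "K > 0" using f.pos_bounded by blast
  \<comment> \<open>The maximum ensures \<open>m / c \<le> 1\<close>, so the radicand in
    \<open>q\<close> is nonnegative.\<close>
  define c where "c = max K m"
  have c: "c \<ge> m" "c > 0" and fc: "norm (f x) \<le> norm x * c" for x
    using K(2) m order_trans[OF K(1)[of x], of "norm x * c"] by (auto simp: c_def mult_left_mono)
  define t where "t = m / c\<^sup>2"
  define q where "q = sqrt (1 - (m / c)\<^sup>2)"
  have mc: "0 < m / c" "m / c \<le> 1" using c m by auto
  then have mc2: "0 < (m / c)\<^sup>2" "(m / c)\<^sup>2 \<le> 1" by (auto simp: power_le_one)
  have t: "t > 0" using m c by (simp add: t_def)
  have "norm (x - t *\<^sub>R f x) \<le> q * norm x" for x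
  proof (rule power2_le_imp_le)
    have "(norm (x - t *\<^sub>R f x))\<^sup>2 = inner x x - 2 * t * inner (f x) x + t\<^sup>2 * (norm (f x))\<^sup>2"
      unfolding norm_diff_scaleR_power2 by (simp add: inner_commute power2_norm_eq_inner)
    also have "\<dots> \<le> inner x x - 2 * t * (m * inner x x) + t\<^sup>2 * (norm x * c)\<^sup>2"
      using t co[of x] fc[of x] by (intro add_mono diff_mono mult_left_mono power_mono) auto
    also have "\<dots> = (1 - (m / c)\<^sup>2) * inner x x"
      using c m by (simp add: t_def power2_eq_square dot_square_norm field_simps)
    also have "\<dots> = (q * norm x)\<^sup>2"
      using mc2 by (simp add: q_def power_mult_distrib dot_square_norm)
    finally show "(norm (x - t *\<^sub>R f x))\<^sup>2 \<le> (q * norm x)\<^sup>2" .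
    show "0 \<le> q * norm x" using mc2 by (simp add: q_def)
  qed
  moreover have "0 \<le> q" "q < 1" using mc2 by (auto simp: q_def)
  ultimately show ?thesis using t by blast
qed

text \<open>A solution of \<open>f z = y\<close> is a fixed point of the contraction
  \<open>z \<mapsto> z - t (f z - y)\<close>. Coercivity also bounds \<open>f\<close> from below,
  which gives injectivity and a bound for the inverse.\<close>

lemma coercive_inverse:
  fixes f :: "'a::{real_inner,banach} \<Rightarrow> 'a"
  assumes f: "bounded_linear f" and m: "m > 0" and co: "\<And>x. m * inner x x \<le> inner (f x) x"
  shows "\<exists>g. bounded_linear g \<and> (\<forall>x. f (g x) = x) \<and> (\<forall>x. g (f x) = x)"
proof -
  interpret f: bounded_linear f by fact
  obtain t q where t: "t > 0" and q: "0 \<le> q" "q < 1"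
    and con: "\<And>x. norm (x - t *\<^sub>R f x) \<le> q * norm x"
    using coercive_contraction[OF assms] by blast
  have "\<exists>z. f z = y" for y
  proof -
    have "\<exists>!z\<in>UNIV. z - t *\<^sub>R (f z - y) = z"
    proof (rule Banach_fix)
      show "complete (UNIV :: 'a set)" by (simp add: complete_UNIV)
      show "dist (a - t *\<^sub>R (f a - y)) (b - t *\<^sub>R (f b - y)) \<le> q * dist a b" for a b
        using con[of "a - b"] by (simp add: dist_norm f.diff algebra_simps)
    qed (use q in auto)
    then show ?thesis using t by auto
  qed
  then obtain g where g: "\<And>y. f (g y) = y" by metis
  have low: "m * norm x \<le> norm (f x)" for x
  proof (cases "x = 0")
    case False
    have "m * norm x * norm x \<le> inner (f x) x" using co[of x] by (simp add: dot_square_norm power2_eq_square mult.assoc)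
    also have "\<dots> \<le> norm (f x) * norm x" using norm_cauchy_schwarz by blast
    finally show ?thesis using False by simp
  qed (use f.zero in simp)
  have inj: "a = b" if "f a = f b" for a b
    using low[of "a - b"] m that by (simp add: f.diff mult_le_0_iff)
  have "bounded_linear g"
  proof (rule bounded_linear_intro[of _ "1 / m"])
    show "norm (g x) \<le> norm x * (1 / m)" for x
      using low[of "g x"] m by (simp add: g field_simps)
  qed (rule inj, simp add: g f.add f.scaleR)+
  with g inj show ?thesis by blast
qed

section \<open>The square root as a fixed point\<close>

lemma continuous_on_blinfun_compose [continuous_intros]:
  fixes f g :: "'c::topological_space \<Rightarrow> 'a::real_normed_vector \<Rightarrow>\<^sub>L 'a"
  assumes "continuous_on S f" "continuous_on S g"
  shows "continuous_on S (\<lambda>x. f x o\<^sub>L g x)"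
  using assms by (rule bounded_bilinear.continuous_on[OF bounded_bilinear_blinfun_compose])

text \<open>After rescaling, \<open>W = I - X\<close> with \<open>X\<close> of norm below 1, and \<open>I - Y\<close> is a square root of it
  iff \<open>Y\<close> is a fixed point of the contraction \<open>Y \<mapsto> (X + Y\<^sup>2) / 2\<close>.  Self-adjointness and the commutation
  relations are closed conditions preserved by this map.\<close>

lemma real_coercive_sqrt_exists:
  fixes W :: "'a::{real_inner,banach} \<Rightarrow> 'a"
  assumes W: "bounded_linear W" and sa: "\<And>x y. inner (W x) y = inner x (W y)"
    and m: "m > 0" and co: "\<And>x. m * inner x x \<le> inner (W x) x"
  shows "\<exists>Q. bounded_linear Q \<and> (\<forall>x y. inner (Q x) y = inner x (Q y)) \<and>
    (\<forall>x. Q (Q x) = W x) \<and> (\<exists>k>0. \<forall>x. k * inner x x \<le> inner (Q x) x) \<and>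
    (\<forall>G. bounded_linear G \<longrightarrow> (\<forall>x. G (W x) = W (G x)) \<longrightarrow> (\<forall>x. G (Q x) = Q (G x)))"
proof -
  interpret W: bounded_linear W by fact
  obtain t q where t: "t > 0" and q: "0 \<le> q" "q < 1"
    and con: "\<And>x. norm (x - t *\<^sub>R W x) \<le> q * norm x"
    using coercive_contraction[OF W m co] by blast
  define X where "X = Blinfun (\<lambda>x. x - t *\<^sub>R W x)"
  have X: "blinfun_apply X x = x - t *\<^sub>R W x" for x
    unfolding X_def by (subst bounded_linear_Blinfun_apply)
      (auto intro!: bounded_linear_intros W)
  have nX: "norm X \<le> q" by (rule norm_blinfun_bound) (use q con in \<open>auto simp: X\<close>)
  \<comment> \<open>Since \<open>X\<close> is affine in \<open>W\<close>, the last condition becomes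
    the claim that \<open>Q\<close> commutes with everything that commutes with
    \<open>W\<close>.\<close>
  define S where "S = cball 0 q \<inter> {Y. \<forall>x y. inner (blinfun_apply Y x) y = inner x (blinfun_apply Y y)} \<inter>
    {Y. \<forall>G. G o\<^sub>L X = X o\<^sub>L G \<longrightarrow> G o\<^sub>L Y = Y o\<^sub>L G}"
  define \<phi> where "\<phi> Y = (1/2) *\<^sub>R (X + (Y o\<^sub>L Y))" for Y
  have "closed S" unfolding S_def
    by (intro closed_Int closed_cball closed_Collect_all closed_Collect_imp closed_Collect_eq
      continuous_intros open_Collect_const)
  then have "complete S" by (simp add: complete_eq_closed)
  moreover have "0 \<in> S" using q by (auto simp: S_def intro!: blinfun_eqI)
  moreover have "\<phi> ` S \<subseteq> S"
  proof safe
    fix Y assume Y: "Y \<in> S"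
    have nY: "norm Y \<le> q" and Ysa: "\<And>x y. inner (blinfun_apply Y x) y = inner x (blinfun_apply Y y)"
      and Yc: "\<And>G. G o\<^sub>L X = X o\<^sub>L G \<Longrightarrow> G o\<^sub>L Y = Y o\<^sub>L G"
      using Y by (auto simp: S_def)
    have "norm (Y o\<^sub>L Y) \<le> norm Y * norm Y" by (rule norm_blinfun_compose)
    also have "\<dots> \<le> q * 1" using nY q by (intro mult_mono) auto
    finally have "norm (\<phi> Y) \<le> q"
      using norm_triangle_ineq[of X "Y o\<^sub>L Y"] nX by (simp add: \<phi>_def)
    moreover have "inner (blinfun_apply (\<phi> Y) x) y = inner x (blinfun_apply (\<phi> Y) y)" for x y
      by (simp add: \<phi>_def blinfun.bilinear_simps X Ysa sa inner_diff_left inner_diff_right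
        inner_add_left inner_add_right)
    moreover have "G o\<^sub>L \<phi> Y = \<phi> Y o\<^sub>L G" if G: "G o\<^sub>L X = X o\<^sub>L G" for G
    proof (rule blinfun_eqI)
      fix x
      have 1: "blinfun_apply G (blinfun_apply X z) = blinfun_apply X (blinfun_apply G z)" for z
        using G by (metis blinfun_apply_blinfun_compose)
      have 2: "blinfun_apply G (blinfun_apply Y z) = blinfun_apply Y (blinfun_apply G z)" for z
        using Yc[OF G] by (metis blinfun_apply_blinfun_compose)
      show "blinfun_apply (G o\<^sub>L \<phi> Y) x = blinfun_apply (\<phi> Y o\<^sub>L G) x"
        by (simp add: \<phi>_def blinfun.bilinear_simps 1 2)
    qed
    ultimately show "\<phi> Y \<in> S" by (simp add: S_def)
  qed
  moreover have "dist (\<phi> Y) (\<phi> Z) \<le> q * dist Y Z" if "Y \<in> S" "Z \<in> S" for Y Z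
  proof -
    have n: "norm Y \<le> q" "norm Z \<le> q" using that by (auto simp: S_def)
    \<comment> \<open>Difference of squares without commutativity; the factor one half offsets the
      two terms and leaves the constant \<open>q\<close>.\<close>
    have "\<phi> Y - \<phi> Z = (1/2) *\<^sub>R ((Y o\<^sub>L (Y - Z)) + ((Y - Z) o\<^sub>L Z))"
      by (rule blinfun_eqI) (simp add: \<phi>_def blinfun.bilinear_simps algebra_simps)
    also have "norm \<dots> \<le> (1/2) * (norm (Y o\<^sub>L (Y - Z)) + norm ((Y - Z) o\<^sub>L Z))"
      by (simp add: norm_triangle_ineq)
    also have "\<dots> \<le> (1/2) * (norm Y * norm (Y - Z) + norm (Y - Z) * norm Z)"
      by (intro mult_left_mono add_mono norm_blinfun_compose) auto
    also have "\<dots> \<le> (1/2) * (q * norm (Y - Z) + norm (Y - Z) * q)"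
      using n q by (intro mult_left_mono add_mono mult_mono) auto
    finally show ?thesis by (simp add: dist_norm)
  qed
  ultimately obtain Y where YS: "Y \<in> S" and fixY: "\<phi> Y = Y"
    using Banach_fix[of S q \<phi>] q by auto
  have nY: "norm Y \<le> q" and Ysa: "\<And>x y. inner (blinfun_apply Y x) y = inner x (blinfun_apply Y y)"
    and Yc: "\<And>G. G o\<^sub>L X = X o\<^sub>L G \<Longrightarrow> G o\<^sub>L Y = Y o\<^sub>L G"
    using YS by (auto simp: S_def)
  have YY: "blinfun_apply Y (blinfun_apply Y x) = 2 *\<^sub>R blinfun_apply Y x - (x - t *\<^sub>R W x)" for x
  proof -
    have "blinfun_apply Y x = (1/2) *\<^sub>R (x - t *\<^sub>R W x + blinfun_apply Y (blinfun_apply Y x))"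
      by (subst fixY[symmetric]) (simp add: \<phi>_def blinfun.bilinear_simps X)
    then have "2 *\<^sub>R blinfun_apply Y x = 2 *\<^sub>R ((1/2) *\<^sub>R (x - t *\<^sub>R W x + blinfun_apply Y (blinfun_apply Y x)))"
      by (rule arg_cong)
    then show ?thesis by simp
  qed
  \<comment> \<open>Undoes the rescaling: \<open>YY\<close> says \<open>(I - Y)^2 = t W\<close>, so
    the factor must square to \<open>1 / t\<close>.\<close>
  define s where "s = 1 / sqrt t"
  have s: "s > 0" "s * s * t = 1" using t by (auto simp: s_def)
  define Q where "Q x = s *\<^sub>R (x - blinfun_apply Y x)" for x
  have "bounded_linear Q" unfolding Q_def by (intro bounded_linear_intros)
  moreover have "inner (Q x) y = inner x (Q y)" for x y
    by (simp add: Q_def Ysa inner_diff_left inner_diff_right)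
  moreover have "Q (Q x) = W x" for x
  proof -
    have "Q (Q x) = (s * s) *\<^sub>R (x - 2 *\<^sub>R blinfun_apply Y x + blinfun_apply Y (blinfun_apply Y x))"
      by (simp add: Q_def blinfun.bilinear_simps algebra_simps scaleR_2)
    also have "\<dots> = (s * s * t) *\<^sub>R W x" by (simp add: YY)
    finally show ?thesis by (simp add: s)
  qed
  moreover have "\<exists>k>0. \<forall>x. k * inner x x \<le> inner (Q x) x"
  proof (intro exI[of _ "s * (1 - q)"] conjI allI)
    show "0 < s * (1 - q)" using s q by simp
    fix x
    have "inner (blinfun_apply Y x) x \<le> norm (blinfun_apply Y x) * norm x"
      by (rule norm_cauchy_schwarz)
    also have "\<dots> \<le> norm Y * norm x * norm x"
      by (intro mult_right_mono norm_blinfun) simp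
    also have "\<dots> \<le> q * norm x * norm x"
      using nY by (intro mult_right_mono) auto
    finally have "(1 - q) * inner x x \<le> inner (x - blinfun_apply Y x) x"
      by (simp add: inner_diff_left dot_square_norm power2_eq_square algebra_simps)
    then show "s * (1 - q) * inner x x \<le> inner (Q x) x"
      using s by (simp add: Q_def mult.assoc)
  qed
  moreover have "G (Q x) = Q (G x)" if G: "bounded_linear G" and c: "\<forall>x. G (W x) = W (G x)" for G x
  proof -
    interpret G: bounded_linear G by fact
    have a: "blinfun_apply (Blinfun G) = G" by (rule bounded_linear_Blinfun_apply) fact
    have "Blinfun G o\<^sub>L X = X o\<^sub>L Blinfun G"
      by (rule blinfun_eqI) (simp add: a X G.diff G.scaleR c)
    from Yc[OF this] have "G (blinfun_apply Y x) = blinfun_apply Y (G x)"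
      by (metis a blinfun_apply_blinfun_compose)
    then show ?thesis by (simp add: Q_def G.diff G.scaleR)
  qed
  ultimately show ?thesis by blast
qed

section \<open>Complex Hilbert spaces\<close>

lemma scaleC_one [simp]: "1 *\<^sub>C x = (x::'a::complex_inner)"
  using scaleC_of_real[of 1 x] by simp

lemma cinner_scaleC_right: "cinner x (c *\<^sub>C y) = cnj c * cinner x (y::'a::complex_inner)"
  by (metis cinner_commute cinner_scaleC_left complex_cnj_mult)

lemma inner_scaleC_right: "inner x (c *\<^sub>C y) = inner (cnj c *\<^sub>C x) (y::'a::complex_inner)"
  by (simp flip: Re_cinner add: cinner_scaleC_left cinner_scaleC_right)

lemma Im_cinner: "Im (cinner x y) = inner x (\<i> *\<^sub>C (y::'a::complex_inner))"
  by (simp flip: Re_cinner add: cinner_scaleC_right)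

text \<open>Reduces complex inner products to real ones, so that the results on real spaces
  apply.\<close>

lemma cinner_eq_Complex: "cinner x y = Complex (inner x y) (inner x (\<i> *\<^sub>C (y::'a::complex_inner)))"
  by (simp add: complex_eq_iff Re_cinner Im_cinner)

text \<open>Views scalar multiplication as a real operator, so that it can take the place of
  \<open>G\<close> in the commutation property of the square root.\<close>

lemma bounded_linear_scaleC: "bounded_linear (\<lambda>x::'a::complex_inner. c *\<^sub>C x)"
proof (rule bounded_linear_intro[of _ "cmod c"])
  show "c *\<^sub>C (r *\<^sub>R x) = r *\<^sub>R (c *\<^sub>C x)" for r and x :: 'a
    by (simp flip: scaleC_of_real add: scaleC_scaleC mult.commute)
  show "norm (c *\<^sub>C x) \<le> norm x * cmod c" for x :: 'a
  proof (rule power2_le_imp_le)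
    have "cnj c *\<^sub>C (c *\<^sub>C x) = complex_of_real ((cmod c)\<^sup>2) *\<^sub>C x"
      by (simp add: scaleC_scaleC complex_norm_square mult.commute del: of_real_power)
    then have "inner (c *\<^sub>C x) (c *\<^sub>C x) = (cmod c)\<^sup>2 * inner x x"
      by (simp only: inner_scaleC_right scaleC_of_real inner_scaleR_left)
    then show "(norm (c *\<^sub>C x))\<^sup>2 \<le> (norm x * cmod c)\<^sup>2"
      by (simp add: power2_norm_eq_inner power_mult_distrib mult.commute)
  qed simp
qed (rule scaleC_add_right)

section \<open>Bounded complex-linear operators on the space and its subspaces\<close>

lemma bounded_ops_UNIV_iff:
  "f \<in> bounded_ops UNIV UNIV \<longleftrightarrow> bounded_linear f \<and> (\<forall>c x. f (c *\<^sub>C x) = c *\<^sub>C f x)"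
proof
  assume f: "f \<in> bounded_ops UNIV UNIV"
  then obtain K where "\<And>x. norm (f x) \<le> K * norm x" by (auto simp: bounded_ops_def)
  moreover have "f (r *\<^sub>R x) = r *\<^sub>R f x" for r x
    using f by (simp add: bounded_ops_def flip: scaleC_of_real)
  ultimately have "bounded_linear f"
    using f by (intro bounded_linear_intro[of _ K]) (auto simp: bounded_ops_def mult.commute)
  with f show "bounded_linear f \<and> (\<forall>c x. f (c *\<^sub>C x) = c *\<^sub>C f x)"
    by (auto simp: bounded_ops_def)
next
  assume f: "bounded_linear f \<and> (\<forall>c x. f (c *\<^sub>C x) = c *\<^sub>C f x)"
  then interpret bounded_linear f by simp
  show "f \<in> bounded_ops UNIV UNIV"
    using f add bounded by (auto simp: bounded_ops_def mult.commute)
qed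

lemma bounded_opsI:
  assumes "f \<in> bounded_ops UNIV UNIV"
    and "\<And>x. x \<in> M \<Longrightarrow> g x = f x" "\<And>x. x \<in> M \<Longrightarrow> f x \<in> N"
    and "\<And>x y. x \<in> M \<Longrightarrow> y \<in> M \<Longrightarrow> x + y \<in> M" "\<And>c x. x \<in> M \<Longrightarrow> c *\<^sub>C x \<in> M"
  shows "g \<in> bounded_ops M N"
  using assms by (auto simp: bounded_ops_def)

text \<open>With \<open>g\<close> a projection onto \<open>M\<close>, this extends an operator known
  only on \<open>M\<close> to the whole space.\<close>

lemma bounded_ops_compose:
  assumes f: "f \<in> bounded_ops M N" and g: "g \<in> bounded_ops UNIV UNIV" "\<And>x. g x \<in> M"
  shows "(\<lambda>x. f (g x)) \<in> bounded_ops UNIV UNIV"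
proof -
  obtain K where K: "\<And>x. x \<in> M \<Longrightarrow> norm (f x) \<le> K * norm x"
    using f unfolding bounded_ops_def by blast
  obtain L where L: "\<And>x. norm (g x) \<le> L * norm x"
    using g(1) unfolding bounded_ops_def by blast
  have "norm (f (g x)) \<le> (\<bar>K\<bar> * L) * norm x" for x
  proof -
    have "norm (f (g x)) \<le> \<bar>K\<bar> * norm (g x)"
      by (rule order_trans[OF K[OF g(2)]]) (simp add: mult_right_mono)
    also have "\<dots> \<le> \<bar>K\<bar> * (L * norm x)" by (intro mult_left_mono L) simp
    finally show ?thesis by (simp add: mult.assoc)
  qed
  with f g show ?thesis by (auto simp: bounded_ops_def)
qed

lemma bounded_ops_add:
  assumes "f \<in> bounded_ops UNIV UNIV" "g \<in> bounded_ops UNIV UNIV"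
  shows "(\<lambda>x. f x + g x) \<in> bounded_ops UNIV UNIV"
  using assms by (auto simp: bounded_ops_UNIV_iff bounded_linear_add scaleC_add_right)

lemma bounded_ops_diff:
  assumes "f \<in> bounded_ops UNIV UNIV" "g \<in> bounded_ops UNIV UNIV"
  shows "(\<lambda>x. f x - g x) \<in> bounded_ops UNIV UNIV"
proof -
  have "c *\<^sub>C (x - y) = c *\<^sub>C x - c *\<^sub>C y" for c and x y :: 'a
    by (rule bounded_linear.linear[OF bounded_linear_scaleC, THEN linear_diff])
  with assms show ?thesis by (auto simp: bounded_ops_UNIV_iff bounded_linear_sub)
qed

lemma bounded_ops_ident: "(\<lambda>x. x) \<in> bounded_ops UNIV UNIV"
  by (simp add: bounded_ops_UNIV_iff bounded_linear_ident)

section \<open>Complex adjoints, projections and positivity\<close>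

lemma cinner_adjoint_of_inner:
  fixes f g :: "'a::complex_inner \<Rightarrow> 'a"
  assumes "\<And>x y. x \<in> M \<Longrightarrow> y \<in> N \<Longrightarrow> inner (f x) y = inner x (g y)"
    and "\<And>y. y \<in> N \<Longrightarrow> \<i> *\<^sub>C y \<in> N" "\<And>y. y \<in> N \<Longrightarrow> g (\<i> *\<^sub>C y) = \<i> *\<^sub>C g y"
    and "x \<in> M" "y \<in> N"
  shows "cinner (f x) y = cinner x (g y)"
  \<comment> \<open>The real identity at \<open>y\<close> and at \<open>\<i> *\<^sub>C y\<close>
    gives the real and the imaginary part.\<close>
  using assms(1)[OF assms(4,5)] assms(1)[OF assms(4) assms(2)[OF assms(5)]] assms(3,5)
  by (simp add: cinner_eq_Complex)

text \<open>The choice in \<open>adj\<close> has a candidate: the real adjoint, which is complex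
  linear because its inner products determine it.\<close>

lemma adj_UNIV:
  fixes f :: "'a::chilbert_space \<Rightarrow> 'a"
  assumes f: "f \<in> bounded_ops UNIV UNIV"
  shows "adj UNIV UNIV f \<in> bounded_ops UNIV UNIV"
    and "inner (f x) y = inner x (adj UNIV UNIV f y)"
proof -
  obtain g where g: "bounded_linear g" and fg: "\<And>x y. inner (f x) y = inner x (g y)"
    using f real_adjoint_exists[of f] by (auto simp: bounded_ops_UNIV_iff)
  have gC: "g (c *\<^sub>C y) = c *\<^sub>C g y" for c y
    by (subst vector_eq_ldot[symmetric])
      (use f in \<open>simp add: inner_scaleC_right bounded_ops_UNIV_iff flip: fg\<close>)
  have "\<exists>g. g \<in> bounded_ops UNIV UNIV \<and> (\<forall>x\<in>UNIV. \<forall>y\<in>UNIV. cinner (f x) y = cinner x (g y))"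
  proof (intro exI[of _ g] conjI ballI)
    show "g \<in> bounded_ops UNIV UNIV" using g gC by (simp add: bounded_ops_UNIV_iff)
    show "cinner (f x) y = cinner x (g y)" for x y
      by (rule cinner_adjoint_of_inner[of UNIV UNIV f g]) (simp_all only: fg gC UNIV_I)
  qed
  from someI_ex[OF this] have *: "adj UNIV UNIV f \<in> bounded_ops UNIV UNIV"
    "\<And>x y. cinner (f x) y = cinner x (adj UNIV UNIV f y)"
    unfolding adj_def by blast+
  show "adj UNIV UNIV f \<in> bounded_ops UNIV UNIV" by (fact *)
  show "inner (f x) y = inner x (adj UNIV UNIV f y)" by (simp only: *(2) flip: Re_cinner)
qed

text \<open>Two candidates differ at \<open>y\<close> by an element of \<open>M\<close> that is
  orthogonal to \<open>M\<close>.\<close>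

lemma adj_eqI:
  fixes M :: "'a::complex_inner set"
  assumes S: "S \<in> bounded_ops N M"
    and adj: "\<And>x y. x \<in> M \<Longrightarrow> y \<in> N \<Longrightarrow> cinner (T x) y = cinner x (S y)"
    and M: "\<And>x y. x \<in> M \<Longrightarrow> y \<in> M \<Longrightarrow> x - y \<in> M" and y: "y \<in> N"
  shows "adj M N T y = S y"
proof -
  have "\<exists>S. S \<in> bounded_ops N M \<and> (\<forall>x\<in>M. \<forall>y\<in>N. cinner (T x) y = cinner x (S y))"
    using S adj by blast
  from someI_ex[OF this] have "adj M N T \<in> bounded_ops N M"
    "\<And>x. x \<in> M \<Longrightarrow> cinner (T x) y = cinner x (adj M N T y)"
    using y unfolding adj_def by blast+
  then have "adj M N T y \<in> M" and eq: "\<And>x. x \<in> M \<Longrightarrow> inner x (adj M N T y) = inner x (S y)"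
    using y adj[OF _ y] by (auto simp: bounded_ops_def Re_cinner[symmetric])
  moreover have "S y \<in> M" using S y by (simp add: bounded_ops_def)
  ultimately have "inner (adj M N T y - S y) (adj M N T y - S y) = 0"
    using eq[OF M] by (simp add: inner_diff_right)
  then show ?thesis by simp
qed

text \<open>Linearity follows from uniqueness: \<open>E x\<close> is the only point of
  \<open>M\<close> whose difference from \<open>x\<close> is orthogonal to \<open>M\<close>.\<close>

lemma complex_projection_exists:
  fixes M :: "'a::chilbert_space set"
  assumes M: "subspace M" "closed M" and C: "\<And>c x. x \<in> M \<Longrightarrow> c *\<^sub>C x \<in> M"
  shows "\<exists>E. E \<in> bounded_ops UNIV UNIV \<and> (\<forall>x y. inner (E x) y = inner x (E y)) \<and>
    (\<forall>x. E x \<in> M) \<and> (\<forall>x\<in>M. E x = x)"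
proof -
  obtain E where E: "\<And>x. E x \<in> M" "\<And>x z. z \<in> M \<Longrightarrow> inner (x - E x) z = 0"
    using orthogonal_projection_exists[OF M] by metis
  have uniq: "e = E x" if "e \<in> M" "\<And>z. z \<in> M \<Longrightarrow> inner (x - e) z = 0" for e x
  proof -
    have d: "e - E x \<in> M" using M that E by (simp add: subspace_diff)
    have "inner (e - E x) (e - E x) = inner (x - E x) (e - E x) - inner (x - e) (e - E x)"
      by (simp add: inner_diff_left)
    also have "\<dots> = 0" using that(2)[OF d] E(2)[OF d] by simp
    finally show ?thesis by simp
  qed
  have orth: "inner x z = inner (E x) z" if "z \<in> M" for x z
    using E(2)[OF that, of x] by (simp add: inner_diff_left)
  have sa: "inner (E x) y = inner x (E y)" for x y
    using orth[OF E(1), of y x] orth[OF E(1), of x y] by (metis inner_commute)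
  have "bounded_linear E"
  proof (rule bounded_linear_intro[of _ 1])
    show "E (x + y) = E x + E y" for x y
    proof (rule uniq[symmetric])
      show "E x + E y \<in> M" using M(1) E(1) by (simp add: subspace_add)
      show "inner (x + y - (E x + E y)) z = 0" if "z \<in> M" for z
        using orth[OF that, of x] orth[OF that, of y] by (simp add: inner_add_left inner_diff_left)
    qed
    show "E (r *\<^sub>R x) = r *\<^sub>R E x" for r x
    proof (rule uniq[symmetric])
      show "r *\<^sub>R E x \<in> M" using M(1) E(1) by (simp add: subspace_mul)
      show "inner (r *\<^sub>R x - r *\<^sub>R E x) z = 0" if "z \<in> M" for z
        using orth[OF that, of x] by (simp add: inner_diff_left)
    qed
    show "norm (E x) \<le> norm x * 1" for x
    proof -
      have "norm (E x) * norm (E x) = inner x (E x)"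
        using orth[OF E(1), of x x] by (simp add: norm_eq_sqrt_inner)
      also have "\<dots> \<le> norm x * norm (E x)" by (rule norm_cauchy_schwarz)
      finally show ?thesis by (cases "E x = 0") simp_all
    qed
  qed
  moreover have "E (c *\<^sub>C x) = c *\<^sub>C E x" for c x
  proof (rule uniq[symmetric])
    show "c *\<^sub>C E x \<in> M" using C E by blast
    fix z assume "z \<in> M"
    then show "inner (c *\<^sub>C x - c *\<^sub>C E x) z = 0"
      using orth[OF C, of z x "cnj c"] inner_scaleC_right[of z c] inner_scaleC_right[of _ "cnj c" z]
      by (simp add: inner_diff_left)
  qed
  moreover have "E x = x" if "x \<in> M" for x
    by (rule uniq[symmetric]) (use that in auto)
  ultimately show ?thesis using E sa by (auto simp: bounded_ops_UNIV_iff)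
qed

text \<open>For self-adjoint \<open>T\<close> the imaginary part
  \<open>inner (T x) (\<i> *\<^sub>C x)\<close> equals its own negative.\<close>

lemma cinner_nonneg_iff:
  fixes T :: "'a::complex_inner \<Rightarrow> 'a"
  assumes T: "T \<in> bounded_ops UNIV UNIV" and sa: "\<And>x y. inner (T x) y = inner x (T y)"
  shows "cinner (T x) x \<in> \<real>\<^sub>\<ge>\<^sub>0 \<longleftrightarrow> 0 \<le> inner (T x) x"
proof -
  have "inner (T x) (\<i> *\<^sub>C x) = inner (T (cnj \<i> *\<^sub>C x)) x"
    using T by (simp add: inner_scaleC_right bounded_ops_UNIV_iff)
  also have "cnj \<i> *\<^sub>C x = (- 1) *\<^sub>R (\<i> *\<^sub>C x)"
    by (simp flip: scaleC_of_real add: scaleC_scaleC del: scaleR_minus1_left)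
  also have "inner (T ((- 1) *\<^sub>R (\<i> *\<^sub>C x))) x = - inner (T x) (\<i> *\<^sub>C x)"
    using T linear_neg[of T "\<i> *\<^sub>C x"] sa[of "\<i> *\<^sub>C x" x] inner_commute[of "\<i> *\<^sub>C x" "T x"]
    by (simp add: bounded_ops_UNIV_iff bounded_linear.linear)
  finally show ?thesis
    by (simp add: cinner_eq_Complex complex_nonneg_Reals_iff)
qed

section \<open>Uniqueness of the square root and its restriction to subspaces\<close>

locale coercive_sqrt =
  fixes W Q V :: "'a::chilbert_space \<Rightarrow> 'a"
  assumes Q_op: "Q \<in> bounded_ops UNIV UNIV" and V_op: "V \<in> bounded_ops UNIV UNIV"
    and Q_selfadj: "inner (Q x) y = inner x (Q y)"
    and Q_coercive: "\<exists>k>0. \<forall>x. k * inner x x \<le> inner (Q x) x"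
    and QQ: "Q (Q x) = W x" and QV: "Q (V x) = x" and VQ: "V (Q x) = x"
    and Q_commute: "bounded_linear G \<Longrightarrow> (\<And>x. G (W x) = W (G x)) \<Longrightarrow> G (Q x) = Q (G x)"
begin

lemma Q_nonneg: "0 \<le> inner (Q x) x"
  using Q_coercive inner_ge_zero[of x] by (meson less_imp_le mult_nonneg_nonneg order_trans)

lemma V_commute:
  assumes "bounded_linear G" "\<And>x. G (W x) = W (G x)"
  shows "G (V x) = V (G x)"
  using Q_commute[OF assms, of "V x"] by (metis QV VQ)

lemma V_nonneg: "0 \<le> inner (V x) x"
  using Q_nonneg[of "V x"] by (simp add: QV inner_commute)

lemma VVW: "V (V (W x)) = x"
  by (simp add: VQ flip: QQ)

text \<open>With \<open>z = Q x - S x\<close>, commutation gives \<open>(Q + S) z = 0\<close>;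
  pairing with \<open>z\<close>, nonnegativity of \<open>S\<close> and coercivity of
  \<open>Q\<close> force \<open>z = 0\<close>. The idempotent \<open>E\<close> restricts the
  comparison to its range.\<close>

lemma sqrt_unique:
  assumes S: "bounded_linear S" and E: "bounded_linear E"
    and EW: "\<And>x. E (W x) = W (E x)" and EE: "\<And>x. E (E x) = E x"
    and SE: "\<And>x. S (E x) = S x" and ES: "\<And>x. E (S x) = S x"
    and SS: "\<And>x. E x = x \<Longrightarrow> S (S x) = W x"
    and S_nonneg: "\<And>x. E x = x \<Longrightarrow> 0 \<le> inner (S x) x" and x: "E x = x"
  shows "S x = Q x"
proof -
  interpret S: bounded_linear S by fact
  interpret E: bounded_linear E by fact
  interpret Q: bounded_linear Q using Q_op by (simp add: bounded_ops_UNIV_iff)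
  \<comment> \<open>Both sides equal \<open>S\<close> applied three times to
    \<open>E z\<close>.\<close>
  have "S (W (E z)) = W (S (E z))" for z
    using SS[OF EE] SS[OF ES] by metis
  then have SW: "S (W z) = W (S z)" for z
    using SE[of "W z"] SE[of z] by (simp add: EW)
  have SQ: "S (Q z) = Q (S z)" for z
    by (rule Q_commute[OF S SW])
  define z where "z = Q x - S x"
  have Ez: "E z = z" using Q_commute[OF E EW, of x] x by (simp add: z_def E.diff ES)
  have "Q z + S z = 0"
    by (simp add: z_def Q.diff S.diff SQ QQ SS[OF x])
  then have "inner (Q z) z + inner (S z) z = 0" by (simp flip: inner_add_left)
  with S_nonneg[OF Ez] have "inner (Q z) z \<le> 0" by simp
  moreover obtain k where k: "k > 0" "k * inner z z \<le> inner (Q z) z" using Q_coercive by blast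
  ultimately have "k * inner z z \<le> 0" by simp
  with k have "inner z z \<le> 0" by (simp only: mult_le_0_iff) auto
  then have "z = 0" using inner_gt_zero_iff[of z] by (auto simp del: inner_gt_zero_iff)
  then show ?thesis by (simp add: z_def)
qed

text \<open>\<open>Q\<close> is itself a candidate for the choice in \<open>sqrt_op\<close>; the
  chosen root, precomposed with \<open>E\<close> to act on the whole space, equals \<open>Q\<close>
  on \<open>M\<close> by \<open>sqrt_unique\<close>.\<close>

lemma sqrt_op_eq:
  assumes E: "E \<in> bounded_ops UNIV UNIV" and EW: "\<And>x. E (W x) = W (E x)"
    and EE: "\<And>x. E (E x) = E x" and M: "M = {x. E x = x}"
    and T: "\<And>x. x \<in> M \<Longrightarrow> T x = W x" and x: "x \<in> M"
  shows "sqrt_op M T x = Q x"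
proof -
  have E_lin: "bounded_linear E" using E by (simp add: bounded_ops_UNIV_iff)
  interpret E: bounded_linear E by fact
  have EC: "E (c *\<^sub>C z) = c *\<^sub>C E z" for c z using E by (simp add: bounded_ops_UNIV_iff)
  have EQ: "E (Q z) = Q (E z)" for z by (rule Q_commute[OF E_lin EW])
  have "Q \<in> bounded_ops M M"
    by (rule bounded_opsI[OF Q_op]) (auto simp: M EQ EC E.add)
  then have "positive_op M Q \<and> (\<forall>x\<in>M. Q (Q x) = T x)"
    by (simp add: positive_op_def cinner_nonneg_iff[OF Q_op Q_selfadj] Q_nonneg T QQ)
  then have "\<exists>S. positive_op M S \<and> (\<forall>x\<in>M. S (S x) = T x)" by blast
  from someI_ex[OF this] have pos: "positive_op M (sqrt_op M T)"
    and sq: "\<And>x. x \<in> M \<Longrightarrow> sqrt_op M T (sqrt_op M T x) = T x"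
    by (auto simp: sqrt_op_def)
  define S where "S z = sqrt_op M T (E z)" for z
  have op: "sqrt_op M T \<in> bounded_ops M M" using pos by (simp add: positive_op_def)
  have SM: "E (S z) = S z" for z
    using op by (auto simp: bounded_ops_def S_def M EE)
  have S: "S \<in> bounded_ops UNIV UNIV" unfolding S_def
    by (rule bounded_ops_compose[OF op E]) (simp add: M EE)
  have "S x = Q x"
  proof (rule sqrt_unique[OF _ E_lin EW EE _ SM])
    show "bounded_linear S" using S by (simp add: bounded_ops_UNIV_iff)
    show "S (E z) = S z" for z by (simp add: S_def EE)
    show "S (S z) = W z" if "E z = z" for z
      using that sq[of z] T[of z] SM[of z] by (simp add: S_def M)
    show "0 \<le> inner (S z) z" if "E z = z" for z
      using that pos by (auto simp: S_def M positive_op_def complex_nonneg_Reals_iff Re_cinner)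
    show "E x = x" using x by (simp add: M)
  qed
  then show ?thesis using x by (simp add: S_def M)
qed

lemma inv_sqrt_op_eq:
  assumes E: "E \<in> bounded_ops UNIV UNIV" and EW: "\<And>x. E (W x) = W (E x)"
    and EE: "\<And>x. E (E x) = E x" and M: "M = {x. E x = x}"
    and T: "\<And>x. x \<in> M \<Longrightarrow> T x = W x" and x: "x \<in> M"
  shows "inv_sqrt_op M T x = V x"
proof -
  note sqrt = sqrt_op_eq[OF E EW EE M T]
  have Vx: "V x \<in> M"
    using x V_commute[of E, OF _ EW, of x] E by (simp add: M bounded_ops_UNIV_iff)
  show ?thesis unfolding inv_sqrt_op_def
  proof (rule inv_into_f_eq)
    show "inj_on (sqrt_op M T) M"
      by (rule inj_onI) (metis sqrt VQ)
    show "V x \<in> M" by fact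
    show "sqrt_op M T (V x) = x" using sqrt[OF _ Vx] by (simp add: QV)
  qed
qed

end

lemma coercive_sqrt_exists:
  fixes W :: "'a::chilbert_space \<Rightarrow> 'a"
  assumes W: "W \<in> bounded_ops UNIV UNIV" and sa: "\<And>x y. inner (W x) y = inner x (W y)"
    and m: "m > 0" and co: "\<And>x. m * inner x x \<le> inner (W x) x"
  shows "\<exists>Q V. coercive_sqrt W Q V"
proof -
  have W_lin: "bounded_linear W" and WC: "\<And>c x. W (c *\<^sub>C x) = c *\<^sub>C W x"
    using W by (auto simp: bounded_ops_UNIV_iff)
  from real_coercive_sqrt_exists[OF W_lin sa m co] obtain Q k where Q: "bounded_linear Q"
      "\<And>x y. inner (Q x) y = inner x (Q y)" "\<And>x. Q (Q x) = W x"
      and k: "k > 0" "\<And>x. k * inner x x \<le> inner (Q x) x"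
      and comm: "\<And>G x. bounded_linear G \<Longrightarrow> (\<And>x. G (W x) = W (G x)) \<Longrightarrow> G (Q x) = Q (G x)"
    by blast
  obtain V where V: "bounded_linear V" "\<And>x. Q (V x) = x" "\<And>x. V (Q x) = x"
    using coercive_inverse[OF Q(1) k] by blast
  \<comment> \<open>Multiplication by \<open>c\<close> is a bounded real-linear map that commutes
    with \<open>W\<close>.\<close>
  have QC: "c *\<^sub>C Q x = Q (c *\<^sub>C x)" for c x
    by (rule comm[OF bounded_linear_scaleC]) (simp add: WC)
  have "V (c *\<^sub>C x) = c *\<^sub>C V x" for c x
    using QC[of c "V x"] by (metis V(2,3))
  with Q V QC have "coercive_sqrt W Q V"
    using k comm by unfold_locales (auto simp: bounded_ops_UNIV_iff)
  then show ?thesis by blast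
qed

section \<open>The diagonal operator of an idempotent\<close>

text \<open>Holds the data of an idempotent \<open>E + F\<close> whose range is that of
  \<open>E\<close>. As operators on the whole space, the blocks compose without tracking
  subspaces.\<close>

locale oblique_blocks =
  fixes E F Fs :: "'a::chilbert_space \<Rightarrow> 'a"
  assumes E_op: "E \<in> bounded_ops UNIV UNIV" and F_op: "F \<in> bounded_ops UNIV UNIV"
    and Fs_op: "Fs \<in> bounded_ops UNIV UNIV"
    and E_selfadj: "inner (E x) y = inner x (E y)" and F_adj: "inner (F x) y = inner x (Fs y)"
    and EE [simp]: "E (E x) = E x" and EF [simp]: "E (F x) = F x" and FE [simp]: "F (E x) = 0"
begin

definition W :: "'a \<Rightarrow> 'a" where
  "W x = x + F (Fs x) + Fs (F x)"

sublocale E: bounded_linear E using E_op by (simp add: bounded_ops_UNIV_iff)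
sublocale F: bounded_linear F using F_op by (simp add: bounded_ops_UNIV_iff)
sublocale Fs: bounded_linear Fs using Fs_op by (simp add: bounded_ops_UNIV_iff)

lemma FsE [simp]: "Fs (E x) = Fs x"
  by (subst vector_eq_ldot[symmetric]) (simp flip: F_adj E_selfadj)

lemma EFs [simp]: "E (Fs x) = 0"
proof -
  have "inner z (E (Fs x)) = inner z 0" for z
    by (simp flip: F_adj E_selfadj)
  then show ?thesis using vector_eq_ldot by blast
qed

lemma FF [simp]: "F (F x) = 0"
  using FE[of "F x"] by (simp del: FE)

lemma FsFs [simp]: "Fs (Fs x) = 0"
  using FsE[of "Fs x"] by (simp del: FsE add: Fs.zero)

lemma W_op: "W \<in> bounded_ops UNIV UNIV"
proof -
  have "(\<lambda>x. F (Fs x)) \<in> bounded_ops UNIV UNIV" "(\<lambda>x. Fs (F x)) \<in> bounded_ops UNIV UNIV"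
    by (auto intro: bounded_ops_compose F_op Fs_op)
  from bounded_ops_add[OF bounded_ops_add[OF bounded_ops_ident this(1)] this(2)]
  show ?thesis by (simp add: W_def[abs_def])
qed

sublocale W: bounded_linear W using W_op by (simp add: bounded_ops_UNIV_iff)

lemma inner_W: "inner (W x) y = inner x y + inner (Fs x) (Fs y) + inner (F x) (F y)"
  using F_adj[of "Fs x" y] F_adj[of y "F x"]
  by (simp add: W_def inner_add_left inner_commute[of "Fs (F x)" y] inner_commute[of "F y" "F x"])

lemma W_selfadj: "inner (W x) y = inner x (W y)"
  using inner_W[of x y] inner_W[of y x] by (simp add: inner_commute)

text \<open>The explicit factor 1 lets this match the constant \<open>m\<close> of
  \<open>coercive_sqrt_exists\<close>.\<close>

lemma W_coercive: "1 * inner x x \<le> inner (W x) x"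
  by (simp add: inner_W)

lemma E_W: "E (W x) = W (E x)"
  by (simp add: W_def E.add Fs.zero)

text \<open>Both sides reduce to \<open>F x + F (Fs (F x))\<close>, because
  \<open>F F = 0\<close>.\<close>

lemma F_W: "F (W x) = W (F x)"
  by (simp add: W_def F.add Fs.zero F.zero)

lemma Fs_W: "Fs (W x) = W (Fs x)"
  by (simp add: W_def Fs.add Fs.zero F.zero)

end

section \<open>The two implications in terms of the blocks of \<open>J\<close>\<close>

locale oblique_root = oblique_blocks E F Fs + coercive_sqrt "oblique_blocks.W F Fs" Q V
  for E F Fs Q V :: "'a::chilbert_space \<Rightarrow> 'a"
begin

sublocale Q: bounded_linear Q using Q_op by (simp add: bounded_ops_UNIV_iff)
sublocale V: bounded_linear V using V_op by (simp add: bounded_ops_UNIV_iff)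

lemmas E_Q = Q_commute[of E, OF E.bounded_linear_axioms E_W]
lemmas F_Q = Q_commute[of F, OF F.bounded_linear_axioms F_W]
lemmas E_V = V_commute[of E, OF E.bounded_linear_axioms E_W]
lemmas F_V = V_commute[of F, OF F.bounded_linear_axioms F_W]

text \<open>With \<open>r = E x\<close> and \<open>y = x - E x\<close>, the idempotent sends
  \<open>x\<close> to \<open>r + F y\<close>. Both forms share
  \<open>inner (J r) r - 2 * inner r (V (F y))\<close>; the rest is \<open>inner (V y) y\<close> on
  the right and \<open>- inner (V (F y)) (F y)\<close> on the left.\<close>

lemma blocks_imp_le:
  assumes J: "bounded_linear J" and sa: "\<And>x y. inner (J x) y = inner x (J y)"
    and J1F: "\<And>y. J1 (F y) = - F y"
    and JE: "\<And>y. E y = 0 \<Longrightarrow> E (J y) = J1 (V (F y))"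
    and JV: "\<And>y. E y = 0 \<Longrightarrow> J y - E (J y) = V y"
    and JR: "\<And>x. E x = x \<Longrightarrow> E (J x) = J1 (V x)"
  shows "inner (J (E x + F x)) (E x + F x) \<le> inner (J x) x"
proof -
  interpret J: bounded_linear J by fact
  define r y where "r = E x" and "y = x - E x"
  have r: "E r = r" and y: "E y = 0" and x: "x = r + y"
    by (simp_all add: r_def y_def E.diff)
  have Px: "E x + F x = r + F y" by (simp add: r_def y_def F.diff)
  have EFy: "E (J (F y)) = - V (F y)"
    using JR[of "F y"] J1F[of "V y"] by (simp add: F_V)
  have Jy: "J y = V y - V (F y)"
    using JE[OF y] JV[OF y] J1F[of "V y"] by (simp add: F_V algebra_simps)
  have *: "inner (J z) (F y) = - inner z (V (F y))" if "E z = z" for z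
  proof -
    have "inner (J z) (F y) = inner (E z) (J (F y))" by (simp add: sa that)
    also have "\<dots> = inner z (- V (F y))" by (simp only: E_selfadj EFy)
    finally show ?thesis by simp
  qed
  \<comment> \<open>\<open>V\<close> commutes with \<open>E\<close>, so it preserves the
    decomposition and the cross terms vanish.\<close>
  have rVy: "inner (V y) r = 0"
    using E_selfadj[of "V y" r] E_V[of y] by (simp add: r y V.zero)
  have VFy: "inner (V (F y)) y = 0"
    using E_selfadj[of "V (F y)" y] E_V[of "F y"] by (simp add: y)
  have "inner (J x) x = inner (J r) r + 2 * inner (J y) r + inner (J y) y"
    using sa[of r y] inner_commute[of r "J y"]
    by (simp add: x J.add inner_add_left inner_add_right)
  also have "\<dots> = inner (J r) r - 2 * inner r (V (F y)) + inner (V y) y"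
    by (simp add: Jy inner_diff_left inner_commute[of "V (F y)" r] rVy VFy)
  finally have 1: "inner (J x) x = inner (J r) r - 2 * inner r (V (F y)) + inner (V y) y" .
  have "inner (J (r + F y)) (r + F y) = inner (J r) r + 2 * inner (J r) (F y) + inner (J (F y)) (F y)"
    using sa[of r "F y"] inner_commute[of r "J (F y)"]
    by (simp add: J.add inner_add_left inner_add_right)
  also have "\<dots> = inner (J r) r - 2 * inner r (V (F y)) - inner (V (F y)) (F y)"
    by (simp add: *[OF r] *[of "F y"] inner_commute[of "F y" "V (F y)"])
  finally show ?thesis
    using V_nonneg[of "F y"] V_nonneg[of y] by (simp add: 1 Px)
qed

text \<open>Prepares the symmetry \<open>J1 = A Q\<close>: the first four conclusions give its
  properties and \<open>V J1 = A\<close>, the last two the columns of \<open>J\<close>.\<close>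

lemma le_imp_blocks:
  assumes J: "bounded_linear J" and sa: "\<And>x y. inner (J x) y = inner x (J y)"
    and JJ: "\<And>x. J (J x) = x"
    and le: "\<And>x. inner (J (E x + F x)) (E x + F x) \<le> inner (J x) x"
  defines "A \<equiv> \<lambda>x. E (J (E x))"
  shows "A (Q (A (Q x))) = E x" and "inner (A (Q x)) y = inner x (A (Q y))"
    and "A (Q (F x)) = - F x" and "V (A (Q x)) = A x"
    and "J (E x) = A x + Fs (A x)" and "E x = 0 \<Longrightarrow> J x = A (F x) + V x"
proof -
  interpret J: bounded_linear J by fact
  have A_lin: "bounded_linear A" unfolding A_def
    by (intro bounded_linear_compose[OF E.bounded_linear_axioms]
      bounded_linear_compose[OF J E.bounded_linear_axioms])
  interpret A: bounded_linear A by fact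
  have EA [simp]: "E (A z) = A z" and AE [simp]: "A (E z) = A z" and FA [simp]: "F (A z) = 0"
    and AFs [simp]: "A (Fs z) = 0" for z
    by (simp_all add: A_def J.zero E.zero)
  have A_sa: "inner (A z) w = inner z (A w)" for z w
    by (simp add: A_def E_selfadj sa)
  \<comment> \<open>The form in \<open>le\<close>, right side minus left side, vanishes at
    \<open>r\<close> because \<open>E + F\<close> fixes \<open>r\<close>; first variation along
    \<open>w + s r\<close> then applies.\<close>
  have J_P: "inner (J r) w = inner (J r) (E w + F w)" if r: "E r = r" for r w
  proof -
    have Fr: "F r = 0" using FE[of r] by (simp add: r del: FE)
    define a where "a = inner (J w) w - inner (J (E w + F w)) (E w + F w)"
    define b where "b = 2 * (inner (J r) w - inner (J r) (E w + F w))"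
    have "0 \<le> a + s * b" for s
    proof -
      have "E (w + s *\<^sub>R r) + F (w + s *\<^sub>R r) = (E w + F w) + s *\<^sub>R r"
        by (simp add: E.add F.add E.scaleR F.scaleR r Fr)
      then have le': "inner (J ((E w + F w) + s *\<^sub>R r)) ((E w + F w) + s *\<^sub>R r)
          \<le> inner (J (w + s *\<^sub>R r)) (w + s *\<^sub>R r)"
        using le[of "w + s *\<^sub>R r"] by simp
      have exp: "inner (J (u + s *\<^sub>R r)) (u + s *\<^sub>R r) =
          inner (J u) u + s * (2 * inner (J r) u) + s * s * inner (J r) r" for u
        using sa[of u r] inner_commute[of u "J r"]
        by (simp add: J.add J.scaleR inner_add_left inner_add_right algebra_simps)
      show ?thesis using le' unfolding exp a_def b_def by (simp add: algebra_simps)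
    qed
    then have "b = 0" by (rule affine_nonneg_imp_slope_zero)
    then show ?thesis by (simp add: b_def)
  qed
  \<comment> \<open>The test vector may be replaced by \<open>E w + F w\<close>, which lies in the
    range of \<open>E\<close>, so that only the corner \<open>A\<close> of \<open>J\<close> enters;
    moving \<open>F\<close> across yields \<open>Fs A\<close>.\<close>
  have J_R: "J (E z) = A z + Fs (A z)" for z
  proof -
    have "inner (J (E z)) w = inner (A z + Fs (A z)) w" for w
    proof -
      have "inner (J (E z)) w = inner (J (E z)) (E w) + inner (J (E z)) (E (F w))"
        using J_P[of "E z" w] by (simp add: inner_add_right)
      also have "\<dots> = inner (A z) w + inner (A z) (F w)"
        by (simp only: A_def E_selfadj)
      also have "\<dots> = inner (A z + Fs (A z)) w"
        using F_adj[of w "A z"]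
        by (simp add: inner_add_left inner_commute[of "A z" "F w"] inner_commute[of "Fs (A z)" w])
      finally show ?thesis .
    qed
    then show ?thesis using vector_eq_rdot by blast
  qed
  have EJ: "E (J w) = A (F w)" if w: "E w = 0" for w
  proof -
    have "inner (E (J w)) z = inner (A (F w)) z" for z
    proof -
      have "inner (E (J w)) z = inner (J (E z)) w" by (metis E_selfadj sa inner_commute)
      also have "\<dots> = inner (J (E z)) (E (F w))" using J_P[of "E z" w] by (simp add: w)
      also have "\<dots> = inner (A z) (F w)" by (simp only: A_def E_selfadj)
      finally show ?thesis by (metis A_sa inner_commute)
    qed
    then show ?thesis using vector_eq_rdot by blast
  qed
  \<comment> \<open>The corner of \<open>J J = I\<close> on the range of \<open>E\<close>:
    \<open>A A + A F Fs A\<close> is \<open>A W A\<close>, since \<open>F A = 0\<close>.\<close>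
  have AWA: "A (W (A z)) = E z" for z
  proof -
    have "E (J (J (E z))) = E (J (E (A z))) + E (J (Fs (A z)))"
      by (simp add: J_R[of z] J.add E.add)
    then have "E z = A (A z) + A (F (Fs (A z)))"
      by (simp add: JJ EJ) (simp add: A_def)
    then show ?thesis by (simp add: W_def A.add Fs.zero A.zero)
  qed
  \<comment> \<open>The product \<open>A W A W A\<close> has \<open>A W A = E\<close> at either end,
    so it equals both \<open>A W\<close> and \<open>W A\<close>.\<close>
  have AW: "A (W z) = W (A z)" for z
  proof -
    have "A (W z) = A (E (W z))" by simp
    also have "\<dots> = A (W (A (W (A z))))" by (simp only: E_W AWA)
    also have "\<dots> = W (A z)" by (simp only: AWA[of "W (A z)"] E_W EA)
    finally show ?thesis .
  qed
  have AQ: "A (Q z) = Q (A z)" for z by (rule Q_commute[OF A_lin AW])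
  \<comment> \<open>The corner of \<open>J\<close> on the complement, extended by zero on the range
    of \<open>E\<close>.\<close>
  define D where "D z = J (z - E z) - E (J (z - E z))" for z
  have D_lin: "bounded_linear D" unfolding D_def
    by (intro bounded_linear_sub bounded_linear_compose[OF J] bounded_linear_compose[OF E.bounded_linear_axioms]
      bounded_linear_ident E.bounded_linear_axioms)
  interpret D: bounded_linear D by fact
  have ED [simp]: "E (D z) = 0" for z by (simp add: D_def E.diff)
  have J_N: "J w = A (F w) + D w" if "E w = 0" for w
    using EJ[OF that] by (simp add: D_def that)
  have D_in: "inner (D z) w = inner (J z) w" if "E w = 0" "E z = 0" for z w
    using E_selfadj[of "J z" w] that by (simp add: D_def inner_diff_left)
  have JJw: "w = A (A (F w)) + Fs (A (A (F w))) + A (F (D w)) + D (D w)" if w: "E w = 0" for w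
  proof -
    have "w = J (A (F w)) + J (D w)" using JJ[of w] J_N[OF w] by (simp add: J.add)
    also have "J (A (F w)) = A (A (F w)) + Fs (A (A (F w)))"
      using J_R[of "A (F w)"] by simp
    also have "J (D w) = A (F (D w)) + D (D w)" by (rule J_N) simp
    finally show ?thesis by (simp add: add.assoc)
  qed
  \<comment> \<open>Range component of \<open>J J w = w\<close>; \<open>A\<close> can be cancelled
    because \<open>A W A = E\<close>.\<close>
  have AFD: "A (F w) = - F (D w)" if w: "E w = 0" for w
  proof -
    have "E (A (A (F w)) + Fs (A (A (F w))) + A (F (D w)) + D (D w)) = 0"
      using JJw[OF w] w by simp
    then have "A (A (F w) + F (D w)) = 0"
      by (simp add: E.add A.add)
    then have "A (W (A (A (F w) + F (D w)))) = 0" by (simp add: W.zero A.zero)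
    then show ?thesis by (simp add: AWA E.add eq_neg_iff_add_eq_0)
  qed
  \<comment> \<open>Complement component of \<open>J J w = w\<close>. Applying \<open>W\<close>
    turns \<open>Fs A A F w\<close> into \<open>Fs F w\<close>, which cancels against the same term
    in \<open>W w\<close>.\<close>
  have WDD: "W (D (D w)) = w" if w: "E w = 0" for w
  proof -
    have "w = Fs (A (A (F w))) + D (D w)"
      using JJw[OF w] AFD[OF w] by (simp add: A.neg flip: A.add)
    then have "W w = Fs (A (W (A (F w)))) + W (D (D w))"
      by (metis AW Fs_W W.add)
    moreover have "Fs w = 0" using FsE[of w] by (simp add: w Fs.zero del: FsE)
    ultimately show ?thesis by (simp add: AWA W_def[of w] F.zero)
  qed
  have E_WD [simp]: "E (W (D z)) = 0" for z by (simp add: E_W W.zero)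
  \<comment> \<open>By \<open>A F = - F D\<close>, the form of \<open>W D\<close> on the complement
    is the gap between the two sides of \<open>le\<close>.\<close>
  have WD_in: "inner (W (D w)) z = inner (D w) z - inner (J (F w)) (F z)" if w: "E w = 0" "E z = 0" for w z
  proof -
    have Fs: "Fs (D w) = 0" using FsE[of "D w"] by (simp add: Fs.zero del: FsE)
    have "inner (J (F w)) (F z) = inner (A (F w)) (F z)"
      using E_selfadj[of "J (F w)" "F z"] by (simp add: A_def)
    also have "\<dots> = - inner (F (D w)) (F z)" by (simp add: AFD[OF w(1)])
    also have "\<dots> = - inner (Fs (F (D w))) z"
      using F_adj[of z "F (D w)"]
      by (simp add: inner_commute[of "F (D w)" "F z"] inner_commute[of "Fs (F (D w))" z])
    finally show ?thesis by (simp add: W_def Fs F.zero inner_add_left)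
  qed
  \<comment> \<open>By \<open>WD_in\<close>, \<open>W D\<close> is symmetric on the complement, so
    it agrees there with its adjoint \<open>D W\<close>.\<close>
  have DW: "D (W w) = W (D w)" if w: "E w = 0" for w
  proof -
    define d where "d = D (W w) - W (D w)"
    have Ed: "E d = 0" by (simp add: d_def E.diff)
    have EWw: "E (W w) = 0" by (simp add: E_W w W.zero)
    have "inner (D (W w)) d = inner (W w) (D d)"
      using D_in[OF Ed EWw] D_in[OF EWw Ed] by (metis sa inner_commute)
    also have "\<dots> = inner (W (D d)) w" by (metis W_selfadj inner_commute)
    also have "\<dots> = inner (W (D w)) d"
    proof -
      have "inner (D d) w = inner (D w) d" using D_in[OF Ed w] D_in[OF w Ed] by (metis sa inner_commute)
      moreover have "inner (J (F d)) (F w) = inner (J (F w)) (F d)" by (metis sa inner_commute)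
      ultimately show ?thesis by (simp add: WD_in[OF Ed w] WD_in[OF w Ed])
    qed
    finally have "inner d d = 0" by (simp add: d_def inner_diff_left)
    then show ?thesis by (simp add: d_def)
  qed
  have DE [simp]: "D (z - E z) = D z" for z by (simp add: D_def E.diff)
  \<comment> \<open>\<open>W D W D = W W D D = W\<close> on the complement, and \<open>le\<close>
    makes \<open>W D\<close> nonnegative; \<open>z - E z\<close> is the projection onto the
    complement.\<close>
  have WD_Q: "W (D w) = Q w" if w: "E w = 0" for w
  proof (rule sqrt_unique[of "\<lambda>z. W (D z)" "\<lambda>z. z - E z"])
    show "bounded_linear (\<lambda>z. W (D z))"
      by (rule bounded_linear_compose[OF W.bounded_linear_axioms D_lin])
    show "bounded_linear (\<lambda>z. z - E z)"
      by (intro bounded_linear_sub bounded_linear_ident E.bounded_linear_axioms)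
    fix z
    show "W (D (W (D z))) = W z" if "z - E z = z"
      using that DW[of "D z"] WDD[of z] by simp
    show "0 \<le> inner (W (D z)) z" if "z - E z = z"
      using that le[of z] WD_in[of z z] D_in[of z z] by simp
  qed (simp_all add: w E_W W.diff E.diff)
  have D_V: "D w = V w" if w: "E w = 0" for w
    using VVW[of "D w"] WD_Q[OF w] by (simp add: VQ)
  show "V (A (Q x)) = A x" by (simp add: AQ VQ)
  show "A (Q (A (Q x))) = E x"
  proof -
    have "A (Q (A (Q x))) = A (Q (Q (A x)))" by (simp only: AQ)
    then show ?thesis by (simp only: QQ AWA)
  qed
  show "inner (A (Q x)) y = inner x (A (Q y))"
    by (simp add: A_sa Q_selfadj AQ)
  show "A (Q (F x)) = - F x"
  proof -
    \<comment> \<open>Removing \<open>E x\<close> leaves \<open>F x\<close> unchanged and makes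
      \<open>AFD\<close> applicable.\<close>
    define w where "w = x - E x"
    have w: "E w = 0" and Fw: "F w = F x" by (simp_all add: w_def E.diff F.diff)
    have EQw: "E (Q w) = 0" by (simp add: E_Q w Q.zero)
    have "A (Q (F w)) = A (F (Q w))" by (simp add: F_Q)
    also have "\<dots> = - F (D (Q w))" by (rule AFD[OF EQw])
    also have "\<dots> = - F w" by (simp add: D_V[OF EQw] VQ)
    finally show ?thesis by (simp add: Fw)
  qed
  show "J (E x) = A x + Fs (A x)" by (rule J_R)
  show "J x = A (F x) + V x" if "E x = 0" using J_N[OF that] D_V[OF that] by simp
qed

end

section \<open>Translation between the blocks and the operators of the statement\<close>

theorem lemma5:
  fixes P P1 J :: "'a::chilbert_space \<Rightarrow> 'a"
  assumes separable: "separable_space (euclidean :: 'a topology)"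
    and P_bounded: "P \<in> bounded_ops UNIV UNIV"
    and P_idempotent: "\<forall>x. P (P x) = P x"
    and P1_bounded: "P1 \<in> bounded_ops (ortho_compl (range P)) (range P)"
    and P_block: "has_block_form (range P) P (\<lambda>x. x) P1 (\<lambda>x. 0) (\<lambda>x. 0)"
    and J_symmetry: "symmetry_on UNIV J"
  shows "loewner_le (adj UNIV UNIV P \<circ> J \<circ> P) J \<longleftrightarrow>
    (let R = range P;
         P1s = adj (ortho_compl R) R P1;
         S = inv_sqrt_op R (\<lambda>x. x + P1 (P1s x));
         S' = inv_sqrt_op (ortho_compl R) (\<lambda>y. y + P1s (P1 y))
     in \<exists>J1. symmetry_on R J1 \<and>
          (\<forall>y\<in>ortho_compl R. J1 (P1 y) + P1 y = 0) \<and>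
          has_block_form R J (J1 \<circ> S) (J1 \<circ> S \<circ> P1) (P1s \<circ> S \<circ> J1) S')"
proof -
  define R where "R = range P"
  define N where "N = ortho_compl R"
  define Ps where "Ps = adj UNIV UNIV P"
  define P1s where "P1s = adj N R P1"
  have P_lin: "bounded_linear P" using P_bounded by (simp add: bounded_ops_UNIV_iff)
  interpret P: bounded_linear P by fact
  have PC: "P (c *\<^sub>C x) = c *\<^sub>C P x" for c x
    using P_bounded by (simp add: bounded_ops_UNIV_iff)
  \<comment> \<open>As the fixed-point set of \<open>P\<close>, the range is visibly closed.\<close>
  have R: "R = {x. P x = x}" using P_idempotent unfolding R_def by (auto intro: range_eqI[OF sym])
  have "subspace R" by (auto simp: R subspace_def P.zero P.add P.scaleR)
  moreover have "closed R" unfolding R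
    by (intro closed_Collect_eq P.continuous_on continuous_on_id)
  ultimately obtain E where E_op: "E \<in> bounded_ops UNIV UNIV"
    and E_sa: "\<And>x y. inner (E x) y = inner x (E y)"
    and E_R: "\<And>x. E x \<in> R" and E_id: "\<And>x. x \<in> R \<Longrightarrow> E x = x"
    using complex_projection_exists[of R] PC by (auto simp: R)
  have Ps_op: "Ps \<in> bounded_ops UNIV UNIV" and Ps: "inner (P x) y = inner x (Ps y)" for x y
    unfolding Ps_def by (rule adj_UNIV[OF P_bounded])+
  define F where "F x = P x - E x" for x
  define Fs where "Fs x = Ps x - E x" for x
  have PE: "P (E x) = E x" for x using E_R by (simp add: R)
  have EE: "E (E x) = E x" and EP: "E (P x) = P x" for x
    using E_id[OF E_R] E_id[of "P x"] by (simp_all add: R_def)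
  interpret E: bounded_linear E using E_op by (simp add: bounded_ops_UNIV_iff)
  interpret oblique_blocks E F Fs
  proof
    show "F \<in> bounded_ops UNIV UNIV" "Fs \<in> bounded_ops UNIV UNIV"
      unfolding F_def Fs_def by (intro bounded_ops_diff P_bounded Ps_op E_op)+
    show "inner (F x) y = inner x (Fs y)" for x y
      by (simp add: F_def Fs_def inner_diff_left inner_diff_right Ps E_sa)
    show "E (F x) = F x" "F (E x) = 0" for x
      by (simp_all add: F_def E.diff EE EP PE)
  qed (use E_op E_sa EE in auto)
  obtain Q V where "coercive_sqrt W Q V"
    using coercive_sqrt_exists[OF W_op W_selfadj _ W_coercive] by auto
  then interpret oblique_root E F Fs Q V
    by (intro oblique_root.intro oblique_blocks_axioms)
  have EC: "E (c *\<^sub>C x) = c *\<^sub>C E x" for c x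
    using E_op by (simp add: bounded_ops_UNIV_iff)
  have C0: "c *\<^sub>C (0::'a) = 0" for c
    by (rule linear_0[OF bounded_linear.linear[OF bounded_linear_scaleC]])
  have R_E: "x \<in> R \<longleftrightarrow> E x = x" for x using E_id E_R by metis
  have N_E: "y \<in> N \<longleftrightarrow> E y = 0" for y
  proof
    assume "y \<in> N"
    then have "inner (E y) y = 0"
      using E_R by (auto simp: N_def ortho_compl_def simp flip: Re_cinner)
    then show "E y = 0" using E_sa[of "E y" y] by (simp add: EE)
  next
    assume y: "E y = 0"
    \<comment> \<open>Taking \<open>c\<close> as 1 and as \<open>\<i>\<close> yields the real and
      the imaginary part of orthogonality.\<close>
    have "inner x (c *\<^sub>C y) = 0" if "x \<in> R" for x c
      using E_sa[of x "c *\<^sub>C y"] E_id[OF that] by (simp add: EC y C0)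
    from this[of _ 1] this[of _ \<i>] show "y \<in> N"
      by (simp add: N_def ortho_compl_def cinner_eq_Complex complex_eq_iff)
  qed
  have R_add: "x + y \<in> R" "x - y \<in> R" if "x \<in> R" "y \<in> R" for x y
    using that by (simp_all add: R_E E.add E.diff)
  have R_C: "c *\<^sub>C x \<in> R" if "x \<in> R" for c x using that by (simp add: R_E EC)
  have N_add: "x + y \<in> N" "x - y \<in> N" if "x \<in> N" "y \<in> N" for x y
    using that by (simp_all add: N_E E.add E.diff)
  have N_C: "c *\<^sub>C x \<in> N" if "x \<in> N" for c x using that by (simp add: N_E EC C0)
  have P1_F: "P1 y = F y" if "y \<in> N" for y
  proof -
    have "0 \<in> R" by (simp add: R P.zero)
    then have "P (0 + y) = (0 + P1 y) + (0 + 0)"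
      using P_block that unfolding has_block_form_def R_def[symmetric] N_def[symmetric] by blast
    then show ?thesis using that by (simp add: F_def N_E)
  qed
  have Fs_N: "Fs x \<in> N" and F_R: "F x \<in> R" for x by (simp_all add: N_E R_E)
  have P1s_Fs: "P1s x = Fs x" if x: "x \<in> R" for x
    unfolding P1s_def
  proof (rule adj_eqI[OF _ _ _ x])
    show "Fs \<in> bounded_ops R N"
      by (rule bounded_opsI[OF Fs_op]) (simp_all add: Fs_N R_add R_C)
    show "cinner (P1 u) v = cinner u (Fs v)" if "u \<in> N" "v \<in> R" for u v
      by (rule cinner_adjoint_of_inner[of N R, OF _ _ _ that])
        (use Fs_op in \<open>simp_all add: P1_F F_adj R_C bounded_ops_UNIV_iff\<close>)
  qed (rule N_add)
  have I_E: "(\<lambda>x. x - E x) \<in> bounded_ops UNIV UNIV"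
    by (rule bounded_ops_diff[OF bounded_ops_ident E_op])
  \<comment> \<open>On \<open>R\<close> the summand \<open>Fs F\<close> of \<open>W\<close>
    vanishes, leaving the operator under the root; on \<open>N\<close> the summand
    \<open>F Fs\<close> vanishes instead.\<close>
  have S: "inv_sqrt_op R (\<lambda>x. x + P1 (P1s x)) x = V x" if "x \<in> R" for x
  proof (rule inv_sqrt_op_eq[OF E_op E_W EE _ _ that])
    show "x + P1 (P1s x) = W x" if "x \<in> R" for x
      using that FE[of x] by (simp add: P1s_Fs P1_F Fs_N W_def R_E Fs.zero del: FE)
  qed (auto simp: R_E)
  have S': "inv_sqrt_op N (\<lambda>y. y + P1s (P1 y)) y = V y" if "y \<in> N" for y
  proof (rule inv_sqrt_op_eq[OF I_E _ _ _ _ that])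
    show "y + P1s (P1 y) = W y" if "y \<in> N" for y
      using that FsE[of y] by (simp add: P1s_Fs P1_F F_R W_def N_E Fs.zero F.zero del: FsE)
  qed (auto simp: N_E E_W W.diff E.diff EE)
  have J_op: "J \<in> bounded_ops UNIV UNIV" and JJ: "\<And>x. J (J x) = x"
    and J_adj: "\<And>x. adj UNIV UNIV J x = J x"
    using J_symmetry by (auto simp: symmetry_on_def)
  have J_lin: "bounded_linear J" using J_op by (simp add: bounded_ops_UNIV_iff)
  interpret J: bounded_linear J by fact
  have J_sa: "inner (J x) y = inner x (J y)" for x y
    using adj_UNIV(2)[OF J_op] by (simp add: J_adj)
  have PEF: "P x = E x + F x" for x by (simp add: F_def)
  \<comment> \<open>\<open>J - Ps J P\<close> is self-adjoint, so the Loewner order becomes a real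
    inequality.\<close>
  have le_iff: "loewner_le (Ps \<circ> J \<circ> P) J \<longleftrightarrow>
      (\<forall>x. inner (J (E x + F x)) (E x + F x) \<le> inner (J x) x)"
  proof -
    have op: "(\<lambda>x. J x - Ps (J (P x))) \<in> bounded_ops UNIV UNIV"
      by (intro bounded_ops_diff J_op bounded_ops_compose[OF Ps_op]
        bounded_ops_compose[OF J_op] P_bounded UNIV_I)
    have Ps': "inner (Ps y) x = inner y (P x)" for x y
      using Ps[of x y] by (simp add: inner_commute)
    have "inner (J x - Ps (J (P x))) y = inner x (J y - Ps (J (P y)))" for x y
      by (simp add: inner_diff_left inner_diff_right J_sa Ps' flip: Ps)
    note iff = cinner_nonneg_iff[OF op this]
    show ?thesis
      by (simp add: loewner_le_def iff inner_diff_left Ps' flip: PEF)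
  qed
  have "loewner_le (Ps \<circ> J \<circ> P) J \<longleftrightarrow> (\<exists>J1. symmetry_on R J1 \<and>
      (\<forall>y\<in>N. J1 (P1 y) + P1 y = 0) \<and>
      has_block_form R J (J1 \<circ> inv_sqrt_op R (\<lambda>x. x + P1 (P1s x)))
        (J1 \<circ> inv_sqrt_op R (\<lambda>x. x + P1 (P1s x)) \<circ> P1)
        (P1s \<circ> inv_sqrt_op R (\<lambda>x. x + P1 (P1s x)) \<circ> J1)
        (inv_sqrt_op N (\<lambda>y. y + P1s (P1 y))))" (is "_ \<longleftrightarrow> (\<exists>J1. ?form J1)")
  proof
    assume "loewner_le (Ps \<circ> J \<circ> P) J"
    then have le: "\<And>x. inner (J (E x + F x)) (E x + F x) \<le> inner (J x) x"
      by (simp add: le_iff)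
    define A where "A x = E (J (E x))" for x
    \<comment> \<open>Forced by the upper left entry: \<open>J1 V\<close> has to be
      \<open>A\<close>, and \<open>Q\<close> inverts \<open>V\<close>.\<close>
    define J1 where "J1 x = A (Q x)" for x
    note blocks = le_imp_blocks[OF J_lin J_sa JJ le, folded A_def]
    have A_op: "A \<in> bounded_ops UNIV UNIV" unfolding A_def
      by (intro bounded_ops_compose[OF E_op] bounded_ops_compose[OF J_op] E_op UNIV_I)
    have J1_op: "J1 \<in> bounded_ops UNIV UNIV" unfolding J1_def
      by (intro bounded_ops_compose[OF A_op] Q_op UNIV_I)
    have A_R: "A x \<in> R" and J1_R: "J1 x \<in> R" for x
      by (simp_all add: A_def J1_def R_E EE)
    have J1_ops: "J1 \<in> bounded_ops R R"
      by (rule bounded_opsI[OF J1_op]) (simp_all add: J1_R R_add R_C)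
    have "adj R R J1 x = J1 x" if x: "x \<in> R" for x
    proof (rule adj_eqI[OF J1_ops _ _ x])
      show "cinner (J1 u) v = cinner u (J1 v)" if "u \<in> R" "v \<in> R" for u v
        by (rule cinner_adjoint_of_inner[of R R, OF _ _ _ that])
          (use J1_op blocks(2) in \<open>simp_all add: R_C bounded_ops_UNIV_iff J1_def\<close>)
    qed (rule R_add)
    then have "symmetry_on R J1"
      using J1_ops by (simp add: symmetry_on_def) (simp add: J1_def blocks(1) R_E)
    moreover have "J1 (P1 y) + P1 y = 0" if "y \<in> N" for y
      by (simp add: J1_def P1_F that blocks(3))
    moreover have "has_block_form R J (J1 \<circ> inv_sqrt_op R (\<lambda>x. x + P1 (P1s x)))
        (J1 \<circ> inv_sqrt_op R (\<lambda>x. x + P1 (P1s x)) \<circ> P1)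
        (P1s \<circ> inv_sqrt_op R (\<lambda>x. x + P1 (P1s x)) \<circ> J1)
        (inv_sqrt_op N (\<lambda>y. y + P1s (P1 y)))"
      unfolding has_block_form_def N_def[symmetric]
    proof (intro conjI ballI)
      have 1: "(J1 \<circ> inv_sqrt_op R (\<lambda>x. x + P1 (P1s x))) x = A x" if "x \<in> R" for x
        by (simp add: S[OF that] J1_def QV)
      have 2: "(J1 \<circ> inv_sqrt_op R (\<lambda>x. x + P1 (P1s x)) \<circ> P1) y = A (F y)" if "y \<in> N" for y
        by (simp add: P1_F[OF that] S F_R J1_def QV)
      \<comment> \<open>Here the root stands to the left of \<open>J1\<close>;
        \<open>blocks(4)\<close> supplies \<open>V (J1 x) = A x\<close>.\<close>
      have 3: "(P1s \<circ> inv_sqrt_op R (\<lambda>x. x + P1 (P1s x)) \<circ> J1) x = Fs (A x)" if "x \<in> R" for x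
        using blocks(4)[of x] by (simp add: S J1_R P1s_Fs A_R) (simp add: J1_def P1s_Fs A_R)
      have V_N: "V y \<in> N" if "y \<in> N" for y using that E_V[of y] by (simp add: N_E V.zero)
      show "J1 \<circ> inv_sqrt_op R (\<lambda>x. x + P1 (P1s x)) \<in> bounded_ops R R"
        by (rule bounded_opsI[OF A_op 1]) (simp_all add: A_R R_add R_C)
      show "J1 \<circ> inv_sqrt_op R (\<lambda>x. x + P1 (P1s x)) \<circ> P1 \<in> bounded_ops N R"
        by (rule bounded_opsI[OF bounded_ops_compose[OF A_op F_op UNIV_I] 2])
          (simp_all add: A_R N_add N_C)
      show "P1s \<circ> inv_sqrt_op R (\<lambda>x. x + P1 (P1s x)) \<circ> J1 \<in> bounded_ops R N"
        by (rule bounded_opsI[OF bounded_ops_compose[OF Fs_op A_op UNIV_I] 3])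
          (simp_all add: Fs_N R_add R_C)
      show "inv_sqrt_op N (\<lambda>y. y + P1s (P1 y)) \<in> bounded_ops N N"
        by (rule bounded_opsI[OF V_op S']) (simp_all add: V_N N_add N_C)
      fix x y assume x: "x \<in> R" and y: "y \<in> N"
      have "J x = A x + Fs (A x)" using blocks(5)[of x] x by (simp add: R_E)
      moreover have "J y = A (F y) + V y" using blocks(6)[of y] y by (simp add: N_E)
      ultimately show "J (x + y) =
        (J1 \<circ> inv_sqrt_op R (\<lambda>x. x + P1 (P1s x))) x +
        (J1 \<circ> inv_sqrt_op R (\<lambda>x. x + P1 (P1s x)) \<circ> P1) y +
        ((P1s \<circ> inv_sqrt_op R (\<lambda>x. x + P1 (P1s x)) \<circ> J1) x +
         inv_sqrt_op N (\<lambda>y. y + P1s (P1 y)) y)"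
        unfolding 1[OF x] 2[OF y] 3[OF x] S'[OF y] J.add by (simp add: algebra_simps)
    qed
    ultimately have "?form J1" by blast
    then show "\<exists>J1. ?form J1" by blast
  next
    assume "\<exists>J1. ?form J1"
    then obtain J1 where J1_sym: "symmetry_on R J1" and J1P1: "\<And>y. y \<in> N \<Longrightarrow> J1 (P1 y) + P1 y = 0"
      and form: "has_block_form R J (J1 \<circ> inv_sqrt_op R (\<lambda>x. x + P1 (P1s x)))
        (J1 \<circ> inv_sqrt_op R (\<lambda>x. x + P1 (P1s x)) \<circ> P1)
        (P1s \<circ> inv_sqrt_op R (\<lambda>x. x + P1 (P1s x)) \<circ> J1)
        (inv_sqrt_op N (\<lambda>y. y + P1s (P1 y)))"
      by blast
    have J1_R: "J1 x \<in> R" if "x \<in> R" for x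
      using J1_sym that by (auto simp: symmetry_on_def bounded_ops_def)
    have V_R: "V x \<in> R" if "x \<in> R" for x using that E_V[of x] by (simp add: R_E)
    have V_N: "V y \<in> N" if "y \<in> N" for y using that E_V[of y] by (simp add: N_E V.zero)
    \<comment> \<open>\<open>F\<close> ignores \<open>E y\<close>, so the relation given on
      \<open>N\<close> extends to all \<open>y\<close>.\<close>
    have J1F: "J1 (F y) = - F y" for y
    proof -
      have *: "y - E y \<in> N" "F (y - E y) = F y" by (simp_all add: N_E E.diff F.diff EE)
      then show ?thesis using J1P1[OF *(1)] by (simp add: P1_F eq_neg_iff_add_eq_0)
    qed
    have J10: "J1 0 = 0" using J1F[of 0] by (simp add: F.zero)
    have zero: "0 \<in> R" "0 \<in> N" by (simp_all add: R_E N_E E.zero)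
    have J_xy: "J (x + y) = J1 (V x) + J1 (V (F y)) + (Fs (V (J1 x)) + V y)"
      if x: "x \<in> R" and y: "y \<in> N" for x y
    proof -
      have "J (x + y) =
        (J1 \<circ> inv_sqrt_op R (\<lambda>x. x + P1 (P1s x))) x +
        (J1 \<circ> inv_sqrt_op R (\<lambda>x. x + P1 (P1s x)) \<circ> P1) y +
        ((P1s \<circ> inv_sqrt_op R (\<lambda>x. x + P1 (P1s x)) \<circ> J1) x +
         inv_sqrt_op N (\<lambda>y. y + P1s (P1 y)) y)"
        using form x y unfolding has_block_form_def N_def[symmetric] by blast
      then show ?thesis
        by (simp add: S S' x y P1_F F_R J1_R P1s_Fs V_R)
    qed
    have J_x: "J x = J1 (V x) + Fs (V (J1 x))" if "x \<in> R" for x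
      using J_xy[OF that zero(2)] by (simp add: F.zero V.zero J10)
    have J_y: "J y = J1 (V (F y)) + V y" if "y \<in> N" for y
      using J_xy[OF zero(1) that] by (simp add: Fs.zero V.zero J10)
    have EJ1: "E (J1 (V (F y))) = J1 (V (F y))" for y
      using J1_R[OF V_R[OF F_R]] by (simp add: R_E)
    have EV: "E (V y) = 0" if "E y = 0" for y using V_N[of y] that by (simp add: N_E)
    show "loewner_le (Ps \<circ> J \<circ> P) J"
      unfolding le_iff
    proof (intro allI blocks_imp_le[of J J1, OF J_lin J_sa J1F])
      show "E (J y) = J1 (V (F y))" if "E y = 0" for y
        using that by (simp add: J_y N_E E.add EJ1 EV)
      show "J y - E (J y) = V y" if "E y = 0" for y
        using that by (simp add: J_y N_E E.add EJ1 EV)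
      show "E (J x) = J1 (V x)" if "E x = x" for x
        using that J1_R[OF V_R, of x] by (simp add: J_x R_E E.add)
    qed
  qed
  then show ?thesis
    by (simp only: Let_def Ps_def P1s_def N_def R_def)
qed

end
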